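(* Let $\mathcal{R}$ be a commutative ring, $F=\{F_n:\mathbb{Z}\to\mathcal{R}\}_{n\ge0}$ an admissible family, $\Gamma$ a negative definite plumbing tree and $k\in m+2\mathbb{Z}^s$. Let $n_0\in\mathbb{Z}$ be a lower bound for $\chi_k$ on $\mathbb{Z}^s$. Then the sequence $(P_k^{n_0},P_k^{n_0+1},P_k^{n_0+2},\dots)$ stabilizes to an element of $q^{\Delta_k}\cdot\widetilde{\mathcal{R}}$. Its limit, denoted $P_{[k]}^\infty$, is an invariant of the $3$-manifold $Y(\Gamma)$ equipped with the $\mathrm{spin}^c$ structure $[k]$; that is, it does not depend on the representative $k\in[k]$, and if $\Gamma_1,\Gamma_2$ are negative definite plumbing trees related by a finite sequence of type (a) and type (b) Neumann moves and their inverses (equivalently, representing the same $3$-manifold), with $\mathrm{spin}^c$ structures $[k_1],[k_2]$ corresponding to each other under the composition of the bijections $\alpha^{\pm1}$ associated with these moves, then $P_{[k_1]}^\infty=P_{[k_2]}^\infty$.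
   Context: **Plumbings.** A plumbing tree $\Gamma$ is a finite tree with vertices $v_1,\dots,v_s$ and integer weights $m_i=m(v_i)$. Let $\delta_i=\delta_{v_i}$ be the degree of $v_i$, $m=(m_1,\dots,m_s)$, $\delta=(\delta_1,\dots,\delta_s)$. The matrix $M$ is the symmetric $s\times s$ matrix with $M_{ii}=m_i$, $M_{ij}=1$ if $i\ne j$ and $v_i,v_j$ are adjacent, and $0$ otherwise. $\Gamma$ is negative definite if $M$ is. $Y(\Gamma)$ is the $3$-manifold obtained by surgery on the framed link with one unknot of framing $m(v)$ for each vertex $v$, adjacent vertices giving Hopf-linked unknots. Write $\langle x,y\rangle=x^tMy$, $\cdot$ for the dot product, $u=(1,\dots,1)$ (so $Mu=m+\delta$), and $(k-Mu)^2:=(k-Mu)^tM^{-1}(k-Mu)$. $\mathrm{Spin}^c$ structures on $Y(\Gamma)$ are identified with classes $[k]\in (m+2\mathbb{Z}^s)/2M\mathbb{Z}^s$. **Neumann moves.** Type (a): $\Gamma$ has an edge joining $v_1,v_2$; $\Gamma'$ is obtained by replacing this edge by a path $v_1',v_0',v_2'$, where the new vertex $v_0'$ has weight $-1$ and $v_1',v_2'$ have weights $m_1-1,m_2-1$ (all else unchanged). Type (b): $\Gamma'$ is obtained by attaching a new leaf $v_0'$ of weight $-1$ to $v_1$, and changing the weight of $v_1$ to $m_1-1$. The vertices of $\Gamma'$ are ordered $v_0',v_1',\dots,v_s'$. By a theorem of Neumann, two negative definite plumbing trees represent the same $3$-manifold if and only if they are related by a finite sequence of such moves and their inverses. The bijection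 $\alpha$ from $(m+2\mathbb{Z}^s)/2M\mathbb{Z}^s$ to $(m'+2\mathbb{Z}^{s+1})/2M'\mathbb{Z}^{s+1}$ is $[k]\mapsto[k']$, with $k'=(0,k)+(1,-1,-1,0,\dots,0)$ for type (a) and $k'=(0,k)+(-1,1,0,\dots,0)$ for type (b). **Admissible families.** $F=\{F_n:\mathbb{Z}\to\mathcal{R}\}_{n\ge0}$ is admissible if (A1) $F_2(0)=1$ and $F_2(r)=0$ for $r\ne0$; (A2) $F_n(r+1)-F_n(r-1)=F_{n-1}(r)$ for all $n\ge1$, $r\in\mathbb{Z}$. Define $F_{\Gamma,k}(x)=\prod_{v}F_{\delta_v}\big((2Mx+k-Mu)_v\big)$ for $x\in\mathbb{Z}^s$, the product over all vertices $v$ of $\Gamma$. **The sequence.** For $x\in\mathbb{Z}^s$ let $\chi_k(x)=-(k\cdot x+\langle x,x\rangle)/2\in\mathbb{Z}$ (bounded below since $M$ is negative definite), $\Delta_k=-\frac{(k-Mu)^2+3s+\sum_v m_v}{4}$, $\Theta_k=\frac{k\cdot u-\langle u,u\rangle}{2}\in\mathbb{Z}$, $\varepsilon_k(x)=\Delta_k+2\chi_k(x)+\langle x,u\rangle$, $\theta_k(x)=\Theta_k+\langle x,u\rangle$. For $n\in\mathbb{Z}$, $P_k^n\in q^{\Delta_k}\cdot\mathcal{R}[q^{\pm1},t^{\pm1}]$ is the sum of the Laurent polynomial weights over the vertices in grading $n$ of the weighted graded root of $(\Gamma,k)$; equivalently, it is the finite sum $P_k^n=\sum_{x\in\mathbb{Z}^s,\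 \chi_k(x)\le n}F_{\Gamma,k}(x)q^{\varepsilon_k(x)}t^{\theta_k(x)}$. **Stabilization.** $\widetilde{\mathcal{R}}$ is the set of Laurent series in $q$ (finitely many negative powers) whose coefficients are Laurent polynomials in $t$ over $\mathcal{R}$. A sequence $f_1,f_2,\dots$ in $q^{\Delta}\cdot\mathcal{R}[q^{\pm1},t^{\pm1}]$ ($\Delta\in\mathbb{Q}$) stabilizes if for all $i,j\in\mathbb{Z}$ the coefficient of $q^{\Delta+i}t^{j}$ in $f_n$ is eventually constant in $n$; its limit is the (a priori bi-infinite) series whose coefficients are these eventual values. "Stabilizes to an element of $q^{\Delta}\cdot\widetilde{\mathcal R}$" means that the limit lies in $q^{\Delta}\cdot\widetilde{\mathcal R}$. *)

theory Defs
  imports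
    "Jordan_Normal_Form.Gauss_Jordan_Elimination"
    "HOL-Library.Poly_Mapping"
    "HOL-Combinatorics.Permutations"
    "HOL-Computational_Algebra.Formal_Laurent_Series"
    "HOL.Equiv_Relations"
begin

section \<open>Plumbing trees\<close>

text \<open>The vertices of a plumbing graph with \<open>s\<close> vertices are \<open>0, \<dots>, s - 1\<close>, where
  \<open>s\<close> is the length of the weight vector; edges are two-element sets of vertices.\<close>

record plumbing =
  weights :: "int vec"
  edges :: "nat set set"

definition nverts :: "plumbing \<Rightarrow> nat" where
  "nverts G = dim_vec (weights G)"

definition adjacent :: "plumbing \<Rightarrow> nat \<Rightarrow> nat \<Rightarrow> bool" where
  "adjacent G i j \<longleftrightarrow> {i, j} \<in> edges G"

definition degree_of :: "plumbing \<Rightarrow> nat \<Rightarrow> nat" where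
  "degree_of G i = card {e \<in> edges G. i \<in> e}"

definition plumbing_tree :: "plumbing \<Rightarrow> bool" where
  "plumbing_tree G \<longleftrightarrow>
     0 < nverts G \<and>
     edges G \<subseteq> {{i, j} |i j. i < nverts G \<and> j < nverts G \<and> i \<noteq> j} \<and>
     (\<forall>i < nverts G. \<forall>j < nverts G. (adjacent G)\<^sup>*\<^sup>* i j) \<and>
     \<not> (\<exists>c. 3 \<le> length c \<and> distinct c \<and> successively (adjacent G) c \<and> adjacent G (last c) (hd c))"

definition plumbing_mat :: "plumbing \<Rightarrow> int mat" where
  "plumbing_mat G = mat (nverts G) (nverts G)
     (\<lambda>(i, j). if i = j then weights G $ i else if adjacent G i j then 1 else 0)"

definition negative_definite :: "plumbing \<Rightarrow> bool" where
  "negative_definite G \<longleftrightarrow>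
     (\<forall>v \<in> carrier_vec (nverts G). v \<noteq> 0\<^sub>v (nverts G) \<longrightarrow>
        v \<bullet> (map_mat real_of_int (plumbing_mat G) *\<^sub>v v) < 0)"

definition pairing :: "plumbing \<Rightarrow> int vec \<Rightarrow> int vec \<Rightarrow> int" where
  "pairing G x y = x \<bullet> (plumbing_mat G *\<^sub>v y)"

definition ones :: "plumbing \<Rightarrow> int vec" where
  "ones G = vec (nverts G) (\<lambda>_. 1)"

text \<open>\<open>chars G\<close> is $m + 2\mathbb{Z}^s$, and \<open>spinc G k\<close> is the class $[k]$ of \<open>k\<close>
  modulo $2M\mathbb{Z}^s$.\<close>

definition chars :: "plumbing \<Rightarrow> int vec set" where
  "chars G = {weights G + 2 \<cdot>\<^sub>v y |y. y \<in> carrier_vec (nverts G)}"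

definition spinc :: "plumbing \<Rightarrow> int vec \<Rightarrow> int vec set" where
  "spinc G k = {k + 2 \<cdot>\<^sub>v (plumbing_mat G *\<^sub>v y) |y. y \<in> carrier_vec (nverts G)}"

section \<open>Neumann moves\<close>

text \<open>In both moves the new vertex is \<open>0\<close> and an old vertex \<open>i\<close> becomes \<open>Suc i\<close>.
  The moves take place at arbitrary vertices \<open>a\<close>, \<open>b\<close>, so that no preliminary
  reordering of the vertices is needed.\<close>

definition move_a :: "nat \<Rightarrow> nat \<Rightarrow> plumbing \<Rightarrow> plumbing" where
  "move_a a b G =
     \<lparr>weights = vCons (-1) (vec (nverts G) (\<lambda>i. if i = a \<or> i = b then weights G $ i - 1 else weights G $ i)),
      edges = {{0, Suc a}, {0, Suc b}} \<union> (`) Suc ` (edges G - {{a, b}})\<rparr>"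

definition alpha_a :: "nat \<Rightarrow> nat \<Rightarrow> int vec \<Rightarrow> int vec" where
  "alpha_a a b k = vCons 1 (vec (dim_vec k) (\<lambda>i. if i = a \<or> i = b then k $ i - 1 else k $ i))"

definition move_b :: "nat \<Rightarrow> plumbing \<Rightarrow> plumbing" where
  "move_b a G =
     \<lparr>weights = vCons (-1) (vec (nverts G) (\<lambda>i. if i = a then weights G $ i - 1 else weights G $ i)),
      edges = {{0, Suc a}} \<union> (`) Suc ` edges G\<rparr>"

definition alpha_b :: "nat \<Rightarrow> int vec \<Rightarrow> int vec" where
  "alpha_b a k = vCons (-1) (vec (dim_vec k) (\<lambda>i. if i = a then k $ i + 1 else k $ i))"

text \<open>Reordering of the vertices: new vertex \<open>i\<close> is old vertex \<open>p i\<close>.\<close>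

definition perm_vec :: "(nat \<Rightarrow> nat) \<Rightarrow> int vec \<Rightarrow> int vec" where
  "perm_vec p k = vec (dim_vec k) (\<lambda>i. k $ p i)"

definition reorder :: "(nat \<Rightarrow> nat) \<Rightarrow> plumbing \<Rightarrow> plumbing" where
  "reorder p G = \<lparr>weights = perm_vec p (weights G), edges = (`) (inv_into UNIV p) ` edges G\<rparr>"

text \<open>A step relates plumbing trees together with spin-c structures, the latter
  corresponding to each other under the bijection of classes induced by the move.
  Plumbing trees do not come with a preferred ordering of their vertices, hence
  reorderings are allowed as steps.\<close>

inductive neumann_step :: "plumbing \<times> int vec set \<Rightarrow> plumbing \<times> int vec set \<Rightarrow> bool" where
  type_a: "\<lbrakk>plumbing_tree G; k \<in> chars G; {a, b} \<in> edges G\<rbrakk> \<Longrightarrow>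
     neumann_step (G, spinc G k) (move_a a b G, spinc (move_a a b G) (alpha_a a b k))"
| type_b: "\<lbrakk>plumbing_tree G; k \<in> chars G; a < nverts G\<rbrakk> \<Longrightarrow>
     neumann_step (G, spinc G k) (move_b a G, spinc (move_b a G) (alpha_b a k))"
| reordering: "\<lbrakk>plumbing_tree G; k \<in> chars G; p permutes {..<nverts G}\<rbrakk> \<Longrightarrow>
     neumann_step (G, spinc G k) (reorder p G, spinc (reorder p G) (perm_vec p k))"

section \<open>Admissible families and the polynomials of a plumbing tree\<close>

text \<open>The sort \<open>{comm_ring, comm_monoid_mult}\<close> describes commutative rings with 1; unlike
  \<open>comm_ring_1\<close> it does not exclude the zero ring.\<close>

definition admissible :: "(nat \<Rightarrow> int \<Rightarrow> 'r :: {comm_ring, comm_monoid_mult}) \<Rightarrow> bool" where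
  "admissible F \<longleftrightarrow>
     F 2 0 = 1 \<and> (\<forall>r. r \<noteq> 0 \<longrightarrow> F 2 r = 0) \<and>
     (\<forall>n \<ge> 1. \<forall>r. F n (r + 1) - F n (r - 1) = F (n - 1) r)"

definition F_weight :: "(nat \<Rightarrow> int \<Rightarrow> 'r :: {comm_ring, comm_monoid_mult}) \<Rightarrow>
    plumbing \<Rightarrow> int vec \<Rightarrow> int vec \<Rightarrow> 'r" where
  "F_weight F G k x = (\<Prod>i < nverts G. F (degree_of G i)
     ((2 \<cdot>\<^sub>v (plumbing_mat G *\<^sub>v x) + k - plumbing_mat G *\<^sub>v ones G) $ i))"

text \<open>For \<open>k \<in> chars G\<close> the divisions by 2 in \<open>chi\<close> and \<open>Theta\<close> are exact.\<close>

definition chi :: "plumbing \<Rightarrow> int vec \<Rightarrow> int vec \<Rightarrow> int" where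
  "chi G k x = (- (k \<bullet> x + pairing G x x)) div 2"

definition Theta :: "plumbing \<Rightarrow> int vec \<Rightarrow> int" where
  "Theta G k = (k \<bullet> ones G - pairing G (ones G) (ones G)) div 2"

definition inverse_square :: "plumbing \<Rightarrow> int vec \<Rightarrow> rat" where
  "inverse_square G w =
     map_vec rat_of_int w \<bullet>
       (the (mat_inverse (map_mat rat_of_int (plumbing_mat G))) *\<^sub>v map_vec rat_of_int w)"

definition Delta :: "plumbing \<Rightarrow> int vec \<Rightarrow> rat" where
  "Delta G k = - (inverse_square G (k - plumbing_mat G *\<^sub>v ones G)
      + 3 * of_nat (nverts G) + of_int (\<Sum>i < nverts G. weights G $ i)) / 4"

definition epsilon :: "plumbing \<Rightarrow> int vec \<Rightarrow> int vec \<Rightarrow> rat" where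
  "epsilon G k x = Delta G k + of_int (2 * chi G k x + pairing G x (ones G))"

definition theta :: "plumbing \<Rightarrow> int vec \<Rightarrow> int vec \<Rightarrow> int" where
  "theta G k x = Theta G k + pairing G x (ones G)"

text \<open>Finite sums of monomials $c q^a t^j$ with rational \<open>a\<close> and integral \<open>j\<close> are the elements
  of the monoid algebra of \<open>rat \<times> int\<close>: \<open>Poly_Mapping.single (a, j) c\<close> is $c q^a t^j$.
  The index set of the sum below is finite when \<open>G\<close> is negative definite.\<close>

definition P_poly :: "(nat \<Rightarrow> int \<Rightarrow> 'r :: {comm_ring, comm_monoid_mult}) \<Rightarrow>
    plumbing \<Rightarrow> int vec \<Rightarrow> int \<Rightarrow> ((rat \<times> int) \<Rightarrow>\<^sub>0 'r)" where
  "P_poly F G k n = (\<Sum>x \<in> {x \<in> carrier_vec (nverts G). chi G k x \<le> n}.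
     Poly_Mapping.single (epsilon G k x, theta G k x) (F_weight F G k x))"

section \<open>Stabilization\<close>

text \<open>$q^\Delta \cdot R[q^{\pm 1}, t^{\pm 1}]$\<close>

definition shifted_laurent_polys :: "rat \<Rightarrow> ((rat \<times> int) \<Rightarrow>\<^sub>0 'r :: zero) set" where
  "shifted_laurent_polys D = {p. \<forall>(a, j) \<in> Poly_Mapping.keys p. a - D \<in> \<int>}"

text \<open>Bi-infinite series with rational exponents of \<open>q\<close> are given by their coefficients:
  \<open>L a j\<close> is the coefficient of $q^a t^j$. The following is the set of those that belong to
  $q^\Delta$ times the Laurent series in \<open>q\<close> whose coefficients are Laurent polynomials in \<open>t\<close>.\<close>

definition shifted_laurent_series :: "rat \<Rightarrow> (rat \<Rightarrow> int \<Rightarrow> 'r :: zero) set" where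
  "shifted_laurent_series D = {L. \<exists>g :: (int \<Rightarrow>\<^sub>0 'r) fls. \<forall>a j.
     L a j = (if a - D \<in> \<int> then Poly_Mapping.lookup (fls_nth g \<lfloor>a - D\<rfloor>) j else 0)}"

definition stabilizes :: "rat \<Rightarrow> (nat \<Rightarrow> ((rat \<times> int) \<Rightarrow>\<^sub>0 'r :: zero)) \<Rightarrow> bool" where
  "stabilizes D f \<longleftrightarrow> (\<forall>n. f n \<in> shifted_laurent_polys D) \<and>
     (\<forall>i j :: int. \<exists>c. \<forall>\<^sub>F n in sequentially. Poly_Mapping.lookup (f n) (D + of_int i, j) = c)"

definition stable_limit :: "(nat \<Rightarrow> ((rat \<times> int) \<Rightarrow>\<^sub>0 'r :: zero)) \<Rightarrow> rat \<Rightarrow> int \<Rightarrow> 'r" where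
  "stable_limit f = (\<lambda>a j. THE c. \<forall>\<^sub>F n in sequentially. Poly_Mapping.lookup (f n) (a, j) = c)"

definition chi_lower_bound :: "plumbing \<Rightarrow> int vec \<Rightarrow> int \<Rightarrow> bool" where
  "chi_lower_bound G k n0 \<longleftrightarrow> (\<forall>x \<in> carrier_vec (nverts G). n0 \<le> chi G k x)"

definition P_seq :: "(nat \<Rightarrow> int \<Rightarrow> 'r :: {comm_ring, comm_monoid_mult}) \<Rightarrow>
    plumbing \<Rightarrow> int vec \<Rightarrow> int \<Rightarrow> nat \<Rightarrow> ((rat \<times> int) \<Rightarrow>\<^sub>0 'r)" where
  "P_seq F G k n0 = (\<lambda>i. P_poly F G k (n0 + int i))"

definition P_infty :: "(nat \<Rightarrow> int \<Rightarrow> 'r :: {comm_ring, comm_monoid_mult}) \<Rightarrow>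
    plumbing \<Rightarrow> int vec \<Rightarrow> int \<Rightarrow> rat \<Rightarrow> int \<Rightarrow> 'r" where
  "P_infty F G k n0 = stable_limit (P_seq F G k n0)"

end

theory Submission
  imports Defs "Jordan_Normal_Form.Determinant"
begin

text \<open>
  The idea is to replace the summation variable \<open>x\<close> by the vector \<open>w = 2Mx + k - Mu\<close>. Completing
  the square shows that the exponent of \<open>q\<close> is \<open>-(w\<^sup>2 + 3s + \<Sum> m\<^sub>v)/4\<close>, where \<open>w\<^sup>2\<close> is taken
  with respect to the inverse form, and that the exponent of \<open>t\<close> is half the sum of the entries
  of \<open>w\<close>; these are \<open>epsilon_eq\<close> and \<open>theta_eq\<close>. The weight of \<open>x\<close> depends on \<open>w\<close> only as well, and \<open>w\<close> runs through
  a translate of the spin-c structure \<open>[k]\<close>. Since \<open>M\<close> is negative definite, the Cauchy--Schwarz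
  inequality bounds the entries of \<open>w\<close> in terms of \<open>w\<^sup>2\<close>, so only finitely many \<open>w\<close> have a
  given exponent of \<open>q\<close>, or an exponent below a given bound (\<open>finite_energy_le\<close>). Hence each
  coefficient is eventually constant, equal to a finite sum \<open>limit_coeff\<close> over those \<open>w\<close> in the translate that
  have the prescribed exponents. This sum depends on \<open>[k]\<close> only, and it is the coefficient of a
  Laurent series because \<open>w\<^sup>2 \<le> 0\<close> bounds the exponent of \<open>q\<close> from below.

  For the moves, let \<open>g\<close> be the indicator vector of the set \<open>A\<close> of old vertices adjacent to the
  new one. The new form satisfies \<open>M'(x\<^sub>0, x) = (d, Mx - d g)\<close> with \<open>d = g \<cdot> x - x\<^sub>0\<close>, and the new
  quadratic form is the old one minus \<open>d\<^sup>2\<close>. Therefore definiteness is preserved, the new vectors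
  are the \<open>(d, w - d g)\<close> with \<open>d\<close> of fixed parity, and their square is \<open>w\<^sup>2 - d\<^sup>2\<close>. In type (a)
  the new vertex has degree 2, (A1) leaves only \<open>d = 0\<close>, and all exponents and weights agree with
  the old ones. In type (b) it has degree 1, \<open>F\<^sub>1\<close> is supported on \<open>d = -1\<close> and \<open>d = 1\<close> with values
  \<open>1\<close> and \<open>-1\<close>, the exponents again agree, and the two weights add up to the old one by (A2) at
  the vertex to which the leaf was attached. A reordering permutes all the data. As definiteness
  passes through every move in both directions, the coefficients are constant along any chain of
  moves between negative definite trees.
\<close>

(* The dollar sign is reserved for entries of vectors. *)
no_notation fps_nth (infixl \<open>$\<close> 75)

section \<open>The intersection form\<close>

text \<open>The matrix of the plumbing with entries in an arbitrary ring. Integral, rational and real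
  entries are all needed: the statements on lattice points are integral, the quadratic form
  inverse to \<open>M\<close> is rational, and definiteness is a condition on real vectors.\<close>

definition form_mat :: "plumbing \<Rightarrow> 'a :: comm_ring_1 mat" where
  "form_mat G = map_mat of_int (plumbing_mat G)"

lemma form_mat_carrier [simp]: "form_mat G \<in> carrier_mat (nverts G) (nverts G)"
  by (simp add: form_mat_def plumbing_mat_def)

lemma dim_form_mat [simp]: "dim_row (form_mat G) = nverts G" "dim_col (form_mat G) = nverts G"
  by (simp_all add: form_mat_def plumbing_mat_def)

lemma form_mat_index:
  "i < nverts G \<Longrightarrow> j < nverts G \<Longrightarrow> form_mat G $$ (i, j) = of_int (plumbing_mat G $$ (i, j))"
  by (simp add: form_mat_def plumbing_mat_def)

lemma form_mat_int: "form_mat G = plumbing_mat G"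
  by (rule eq_matI) (simp_all add: form_mat_def)

lemma plumbing_mat_carrier [simp]: "plumbing_mat G \<in> carrier_mat (nverts G) (nverts G)"
  by (simp add: plumbing_mat_def)

lemma dim_plumbing_mat [simp]:
  "dim_row (plumbing_mat G) = nverts G" "dim_col (plumbing_mat G) = nverts G"
  by (simp_all add: plumbing_mat_def)

lemma plumbing_mat_sym:
  "i < nverts G \<Longrightarrow> j < nverts G \<Longrightarrow> plumbing_mat G $$ (i, j) = plumbing_mat G $$ (j, i)"
  by (auto simp: plumbing_mat_def adjacent_def insert_commute)

lemma plumbing_mat_diag: "i < nverts G \<Longrightarrow> plumbing_mat G $$ (i, i) = weights G $ i"
  by (simp add: plumbing_mat_def)

lemma form_mat_mult_carrier [simp]:
  "x \<in> carrier_vec (nverts G) \<Longrightarrow> form_mat G *\<^sub>v x \<in> carrier_vec (nverts G)"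
  using mult_mat_vec_carrier[OF form_mat_carrier] .

lemma ones_carrier [simp]: "ones G \<in> carrier_vec (nverts G)"
  by (simp add: ones_def)

lemma scalar_prod_sum:
  "w \<in> carrier_vec n \<Longrightarrow> v \<bullet> w = (\<Sum>i<n. v $ i * w $ i)"
  by (auto simp: scalar_prod_def atLeast0LessThan)

lemma form_mat_mult_index:
  assumes "x \<in> carrier_vec (nverts G)" "i < nverts G"
  shows "(form_mat G *\<^sub>v x) $ i = (\<Sum>j<nverts G. of_int (plumbing_mat G $$ (i, j)) * x $ j)"
  using assms by (simp add: scalar_prod_sum[OF assms(1)] form_mat_index)

lemma form_mat_add:
  assumes "x \<in> carrier_vec (nverts G)" "y \<in> carrier_vec (nverts G)"
  shows "form_mat G *\<^sub>v (x + y) = form_mat G *\<^sub>v x + form_mat G *\<^sub>v y"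
  using mult_add_distrib_mat_vec[OF form_mat_carrier assms] .

lemma form_mat_smult:
  "x \<in> carrier_vec (nverts G) \<Longrightarrow> form_mat G *\<^sub>v (c \<cdot>\<^sub>v x) = c \<cdot>\<^sub>v (form_mat G *\<^sub>v x)"
  by (rule eq_vecI)
    (simp_all add: form_mat_mult_index sum_distrib_left mult.left_commute del: index_mult_mat_vec)

lemma form_sum:
  assumes "x \<in> carrier_vec (nverts G)" "y \<in> carrier_vec (nverts G)"
  shows "x \<bullet> (form_mat G *\<^sub>v y)
    = (\<Sum>i<nverts G. \<Sum>j<nverts G. x $ i * of_int (plumbing_mat G $$ (i, j)) * y $ j)"
  using assms
  by (simp add: scalar_prod_sum[of _ "nverts G"] form_mat_mult_index sum_distrib_left mult.assoc
      del: index_mult_mat_vec)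

lemma form_sym:
  assumes "x \<in> carrier_vec (nverts G)" "y \<in> carrier_vec (nverts G)"
  shows "x \<bullet> (form_mat G *\<^sub>v y) = y \<bullet> (form_mat G *\<^sub>v x)"
proof -
  have "(\<Sum>i<nverts G. \<Sum>j<nverts G. x $ i * of_int (plumbing_mat G $$ (i, j)) * y $ j)
    = (\<Sum>i<nverts G. \<Sum>j<nverts G. x $ j * of_int (plumbing_mat G $$ (j, i)) * y $ i)"
    by (rule sum.swap)
  also have "\<dots> = (\<Sum>i<nverts G. \<Sum>j<nverts G. y $ i * of_int (plumbing_mat G $$ (i, j)) * x $ j)"
    by (intro sum.cong refl) (auto simp: plumbing_mat_sym[of _ G] mult_ac)
  finally show ?thesis
    using assms by (simp only: form_sum)
qed

lemma form_combination:
  fixes x y :: "'a :: comm_ring_1 vec"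
  assumes "x \<in> carrier_vec (nverts G)" "y \<in> carrier_vec (nverts G)"
  shows "(c \<cdot>\<^sub>v x + y) \<bullet> (form_mat G *\<^sub>v (c \<cdot>\<^sub>v x + y))
    = c\<^sup>2 * (x \<bullet> (form_mat G *\<^sub>v x)) + 2 * c * (x \<bullet> (form_mat G *\<^sub>v y)) + y \<bullet> (form_mat G *\<^sub>v y)"
proof -
  have "form_mat G *\<^sub>v (c \<cdot>\<^sub>v x + y) = c \<cdot>\<^sub>v (form_mat G *\<^sub>v x) + form_mat G *\<^sub>v y"
    using assms by (simp add: form_mat_add form_mat_smult)
  moreover have "y \<bullet> (form_mat G *\<^sub>v x) = x \<bullet> (form_mat G *\<^sub>v y)"
    by (rule form_sym[OF assms(2,1)])
  ultimately show ?thesis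
    using assms by (simp add: scalar_prod_add_distrib[of _ "nverts G"] add_scalar_prod_distrib[of _ "nverts G"]
        power2_eq_square) (simp add: algebra_simps)
qed

lemma of_int_scalar_prod:
  assumes "w \<in> carrier_vec n" "v \<in> carrier_vec n"
  shows "of_int (v \<bullet> w) = map_vec of_int v \<bullet> (map_vec of_int w :: 'a :: comm_ring_1 vec)"
  using assms by (simp add: scalar_prod_sum[of _ n])

lemma of_int_form_mat:
  assumes "x \<in> carrier_vec (nverts G)"
  shows "map_vec of_int (plumbing_mat G *\<^sub>v x) = (form_mat G *\<^sub>v map_vec of_int x :: 'a :: comm_ring_1 vec)"
proof (rule eq_vecI)
  fix i assume "i < dim_vec (form_mat G *\<^sub>v map_vec of_int x :: 'a vec)"
  then have i: "i < nverts G" by simp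
  show "map_vec of_int (plumbing_mat G *\<^sub>v x) $ i = (form_mat G *\<^sub>v map_vec of_int x :: 'a vec) $ i"
    using assms i form_mat_mult_index[of x G i, unfolded form_mat_int]
    by (simp add: form_mat_mult_index del: index_mult_mat_vec)
qed simp

section \<open>Negative definite forms\<close>

lemma negative_definite_iff:
  "negative_definite G \<longleftrightarrow> (\<forall>v \<in> carrier_vec (nverts G). v \<noteq> 0\<^sub>v (nverts G) \<longrightarrow>
     v \<bullet> (form_mat G *\<^sub>v v) < (0 :: real))"
  by (simp add: negative_definite_def form_mat_def)

lemma negative_definite_rat:
  assumes "negative_definite G" "v \<in> carrier_vec (nverts G)" "v \<noteq> 0\<^sub>v (nverts G)"
  shows "v \<bullet> (form_mat G *\<^sub>v v) < (0 :: rat)"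
proof -
  let ?r = "map_vec real_of_rat v"
  have "?r \<noteq> 0\<^sub>v (nverts G)"
    using assms(2,3) by (auto simp: vec_eq_iff)
  then have "?r \<bullet> (form_mat G *\<^sub>v ?r) < 0"
    using assms(1,2) by (simp add: negative_definite_iff)
  moreover have "?r \<bullet> (form_mat G *\<^sub>v ?r) = real_of_rat (v \<bullet> (form_mat G *\<^sub>v v))"
    using assms(2) by (simp add: form_sum of_rat_sum of_rat_mult)
  ultimately show ?thesis
    by simp
qed

lemma negative_definite_rat_le:
  assumes "negative_definite G" "v \<in> carrier_vec (nverts G)"
  shows "v \<bullet> (form_mat G *\<^sub>v v) \<le> (0 :: rat)"
proof (cases "v = 0\<^sub>v (nverts G)")
  case True
  then show ?thesis using assms(2) by (simp add: form_sum)
next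
  case False
  then show ?thesis using negative_definite_rat[OF assms] by simp
qed

lemma negative_definite_inverse:
  assumes "negative_definite G"
  obtains B where "mat_inverse (form_mat G :: rat mat) = Some B"
    "B \<in> carrier_mat (nverts G) (nverts G)" "form_mat G * B = 1\<^sub>m (nverts G)"
    "B * form_mat G = 1\<^sub>m (nverts G)"
proof -
  let ?A = "form_mat G :: rat mat" and ?n = "nverts G"
  have "det ?A \<noteq> 0"
  proof
    assume "det ?A = 0"
    then obtain v where v: "v \<in> carrier_vec ?n" "v \<noteq> 0\<^sub>v ?n" "?A *\<^sub>v v = 0\<^sub>v ?n"
      using det_0_iff_vec_prod_zero[OF form_mat_carrier] by blast
    with negative_definite_rat[OF assms v(1,2)] show False by simp
  qed
  then have "?A \<in> Units (ring_mat TYPE(rat) ?n undefined)"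
    by (rule det_non_zero_imp_unit[OF form_mat_carrier])
  then have "mat_inverse ?A \<noteq> None"
    using mat_inverse(1)[OF form_mat_carrier, where b = undefined] by auto
  then obtain B where B: "mat_inverse ?A = Some B"
    by auto
  show ?thesis
    by (rule that[OF B]) (use mat_inverse(2)[OF form_mat_carrier B] in simp_all)
qed

lemma inverse_square_preimage:
  assumes "negative_definite G" "w \<in> carrier_vec (nverts G)"
  obtains z where "z \<in> carrier_vec (nverts G)" "form_mat G *\<^sub>v z = map_vec rat_of_int w"
proof -
  obtain B where B: "B \<in> carrier_mat (nverts G) (nverts G)" "form_mat G * B = (1\<^sub>m (nverts G) :: rat mat)"
    using negative_definite_inverse[OF assms(1)] by metis
  let ?w = "map_vec rat_of_int w"
  have w: "?w \<in> carrier_vec (nverts G)" using assms(2) by simp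
  have "form_mat G *\<^sub>v (B *\<^sub>v ?w) = (form_mat G * B) *\<^sub>v ?w"
    using assoc_mult_mat_vec[OF form_mat_carrier B(1) w] by simp
  then have "form_mat G *\<^sub>v (B *\<^sub>v ?w) = ?w"
    using B(2) w by simp
  then show ?thesis
    using that[of "B *\<^sub>v ?w"] B(1) w by simp
qed

text \<open>The inverse quadratic form is computed from any preimage under \<open>M\<close>, which spares
  manipulations of the inverse matrix itself.\<close>

lemma inverse_square_eq:
  assumes "negative_definite G" "w \<in> carrier_vec (nverts G)"
    and "z \<in> carrier_vec (nverts G)" "form_mat G *\<^sub>v z = map_vec rat_of_int w"
  shows "inverse_square G w = map_vec rat_of_int w \<bullet> z"
proof -
  obtain B where B: "mat_inverse (form_mat G :: rat mat) = Some B"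
    "B \<in> carrier_mat (nverts G) (nverts G)" "B * form_mat G = (1\<^sub>m (nverts G) :: rat mat)"
    using negative_definite_inverse[OF assms(1)] by metis
  have "B *\<^sub>v map_vec rat_of_int w = (B * form_mat G) *\<^sub>v z"
    using assoc_mult_mat_vec[OF B(2) form_mat_carrier assms(3)] assms(4) by simp
  then have "B *\<^sub>v map_vec rat_of_int w = z"
    using B(3) assms(3) by simp
  then show ?thesis
    using B(1) by (simp add: inverse_square_def form_mat_def)
qed

lemma negative_definite_form_eq:
  assumes "negative_definite G" "z \<in> carrier_vec (nverts G)" "form_mat G *\<^sub>v z = map_vec rat_of_int w"
    and "w \<in> carrier_vec (nverts G)"
  shows "inverse_square G w = z \<bullet> (form_mat G *\<^sub>v z)"
  using assms inverse_square_eq[OF assms(1,4,2,3)] comm_scalar_prod[of z "nverts G" "map_vec rat_of_int w"]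
  by simp

lemma inverse_square_nonpos:
  assumes "negative_definite G" "w \<in> carrier_vec (nverts G)"
  shows "inverse_square G w \<le> 0"
proof -
  obtain z where "z \<in> carrier_vec (nverts G)" "form_mat G *\<^sub>v z = map_vec rat_of_int w"
    using inverse_square_preimage[OF assms] .
  then show ?thesis
    using negative_definite_form_eq[OF assms(1) _ _ assms(2)] negative_definite_rat_le[OF assms(1)] by metis
qed

text \<open>The Cauchy--Schwarz inequality for \<open>-M\<close>, applied to a basis vector and to \<open>M\<inverse>w\<close>.\<close>

lemma square_entry_le:
  assumes G: "negative_definite G" and w: "w \<in> carrier_vec (nverts G)" and i: "i < nverts G"
  shows "of_int ((w $ i)\<^sup>2) \<le> of_int (weights G $ i) * inverse_square G w"
    and "weights G $ i < 0"
proof -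
  obtain z where z: "z \<in> carrier_vec (nverts G)" "form_mat G *\<^sub>v z = map_vec rat_of_int w"
    using inverse_square_preimage[OF G w] .
  let ?A = "form_mat G :: rat mat" and ?e = "unit_vec (nverts G) i :: rat vec"
  define m where "m = rat_of_int (weights G $ i)"
  define b where "b = rat_of_int (w $ i)"
  have e: "?e \<in> carrier_vec (nverts G)" by simp
  have ez: "?e \<bullet> (?A *\<^sub>v z) = b"
    using z(2) w i by (simp add: b_def)
  have ze: "z \<bullet> (?A *\<^sub>v ?e) = b"
    using ez form_sym[OF e z(1)] by simp
  have ee: "?e \<bullet> (?A *\<^sub>v ?e) = m"
    using i by (simp add: m_def form_mat_index plumbing_mat_diag)
  have "?e \<noteq> 0\<^sub>v (nverts G)" using i by simp
  then have m: "m < 0"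
    using negative_definite_rat[OF G e] ee by simp
  then show "weights G $ i < 0" by (simp add: m_def)
  have zz: "z \<bullet> (?A *\<^sub>v z) = inverse_square G w"
    using negative_definite_form_eq[OF G z w] by simp
  \<comment> \<open>\<open>m z - b e\<close> is orthogonal to \<open>e\<close>; its square is \<open>m (m w\<^sup>2 - b\<^sup>2)\<close>\<close>
  let ?y = "(- b) \<cdot>\<^sub>v ?e"
  let ?v = "m \<cdot>\<^sub>v z + ?y"
  have y: "?y \<in> carrier_vec (nverts G)" by simp
  have Ay: "?A *\<^sub>v ?y = (- b) \<cdot>\<^sub>v (?A *\<^sub>v ?e)"
    by (rule form_mat_smult[OF e])
  have zy: "z \<bullet> (?A *\<^sub>v ?y) = - b * b"
    unfolding Ay using scalar_prod_smult_distrib[OF z(1) form_mat_mult_carrier[OF e]] ze by simp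
  have "?y \<bullet> (?A *\<^sub>v ?y) = (- b) * ((- b) * (?e \<bullet> (?A *\<^sub>v ?e)))"
    unfolding Ay using e form_mat_mult_carrier[OF e]
    by (simp only: smult_scalar_prod_distrib[of _ "nverts G"] scalar_prod_smult_distrib[of _ "nverts G"]
        smult_carrier_vec)
  then have yy: "?y \<bullet> (?A *\<^sub>v ?y) = b\<^sup>2 * m"
    unfolding ee by (simp add: power2_eq_square)
  have "?v \<bullet> (?A *\<^sub>v ?v) = m * (m * inverse_square G w - b\<^sup>2)"
    unfolding form_combination[OF z(1) y] zz zy yy by (simp add: algebra_simps power2_eq_square)
  moreover have "?v \<bullet> (?A *\<^sub>v ?v) \<le> 0"
    using negative_definite_rat_le[OF G] z(1) by simp
  ultimately have "m * inverse_square G w - b\<^sup>2 \<ge> 0"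
    using m by (simp add: mult_le_0_iff)
  then show "of_int ((w $ i)\<^sup>2) \<le> of_int (weights G $ i) * inverse_square G w"
    by (simp add: m_def b_def)
qed

lemma finite_int_box: "finite {w :: int vec. w \<in> carrier_vec n \<and> (\<forall>i<n. \<bar>w $ i\<bar> \<le> K)}"
proof (rule finite_subset)
  show "{w :: int vec. w \<in> carrier_vec n \<and> (\<forall>i<n. \<bar>w $ i\<bar> \<le> K)}
    \<subseteq> vec_of_list ` {xs. set xs \<subseteq> {-K..K} \<and> length xs = n}"
  proof
    fix w :: "int vec" assume w: "w \<in> {w. w \<in> carrier_vec n \<and> (\<forall>i<n. \<bar>w $ i\<bar> \<le> K)}"
    then have "set (list_of_vec w) \<subseteq> {-K..K}" "length (list_of_vec w) = n"
      by (auto simp: set_list_of_vec vec_set_def abs_le_iff)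
    then show "w \<in> vec_of_list ` {xs. set xs \<subseteq> {-K..K} \<and> length xs = n}"
      using vec_list[of w] by (metis (mono_tags, lifting) imageI mem_Collect_eq)
  qed
qed (simp add: finite_lists_length_eq)

lemma finite_inverse_square_ge:
  assumes G: "negative_definite G"
  shows "finite {w \<in> carrier_vec (nverts G). B \<le> inverse_square G w}"
proof (rule finite_subset[OF _ finite_int_box])
  define N where "N = max 0 \<lceil>- B\<rceil>"
  define S where "S = (\<Sum>i<nverts G. \<bar>weights G $ i\<bar>)"
  show "{w \<in> carrier_vec (nverts G). B \<le> inverse_square G w}
    \<subseteq> {w. w \<in> carrier_vec (nverts G) \<and> (\<forall>i<nverts G. \<bar>w $ i\<bar> \<le> S * N)}"
  proof safe
    fix w i assume w: "w \<in> carrier_vec (nverts G)" "B \<le> inverse_square G w" and i: "i < nverts G"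
    have "- inverse_square G w \<le> of_int N"
      using w(2) unfolding N_def by linarith
    moreover have "weights G $ i < 0" by (rule square_entry_le(2)[OF G w(1) i])
    ultimately have "(- of_int (weights G $ i)) * (- inverse_square G w) \<le> (- of_int (weights G $ i)) * rat_of_int N"
      by (intro mult_left_mono) auto
    then have "of_int ((w $ i)\<^sup>2) \<le> (- of_int (weights G $ i)) * rat_of_int N"
      using square_entry_le(1)[OF G w(1) i] by simp
    also have "\<dots> = of_int (- (weights G $ i) * N)" by simp
    finally have "(w $ i)\<^sup>2 \<le> - (weights G $ i) * N"
      unfolding of_int_le_iff .
    also have "\<dots> \<le> S * N"
    proof (rule mult_right_mono)
      have "\<bar>weights G $ i\<bar> \<le> S" unfolding S_def using i by (intro member_le_sum) auto
      then show "- (weights G $ i) \<le> S" by simp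
    qed (simp add: N_def)
    finally have "(w $ i)\<^sup>2 \<le> S * N" .
    moreover have "\<bar>w $ i\<bar> \<le> (w $ i)\<^sup>2"
      using self_le_power[of "\<bar>w $ i\<bar>" 2] by (cases "w $ i = 0") auto
    ultimately show "\<bar>w $ i\<bar> \<le> S * N" by simp
  qed
qed

section \<open>Exponents in terms of the shifted characteristic vector\<close>

text \<open>The vector \<open>w = 2Mx + k - Mu\<close>. The exponents of \<open>q\<close> and \<open>t\<close> and the weight of the
  lattice point \<open>x\<close> depend on \<open>w\<close> only.\<close>

definition shifted_char :: "plumbing \<Rightarrow> int vec \<Rightarrow> int vec \<Rightarrow> int vec" where
  "shifted_char G k x = 2 \<cdot>\<^sub>v (plumbing_mat G *\<^sub>v x) + k - plumbing_mat G *\<^sub>v ones G"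

text \<open>The exponent of \<open>q\<close> as a function of \<open>w\<close>.\<close>

definition energy :: "plumbing \<Rightarrow> int vec \<Rightarrow> rat" where
  "energy G w = - (inverse_square G w + 3 * of_nat (nverts G) + of_int (\<Sum>i<nverts G. weights G $ i)) / 4"

text \<open>The product of the values of the admissible family as a function of \<open>w\<close>.\<close>

definition vertex_weight ::
    "(nat \<Rightarrow> int \<Rightarrow> 'r :: {comm_ring, comm_monoid_mult}) \<Rightarrow> plumbing \<Rightarrow> int vec \<Rightarrow> 'r" where
  "vertex_weight F G w = (\<Prod>i<nverts G. F (degree_of G i) (w $ i))"

lemma F_weight_eq: "F_weight F G k x = vertex_weight F G (shifted_char G k x)"
  by (simp add: F_weight_def vertex_weight_def shifted_char_def)

lemma Delta_eq: "Delta G k = energy G (k - plumbing_mat G *\<^sub>v ones G)"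
  by (simp add: Delta_def energy_def)

lemma plumbing_mat_mult_carrier [simp]:
  "x \<in> carrier_vec (nverts G) \<Longrightarrow> plumbing_mat G *\<^sub>v x \<in> carrier_vec (nverts G)"
  using mult_mat_vec_carrier[OF plumbing_mat_carrier] .

lemma shifted_char_carrier:
  "k \<in> carrier_vec (nverts G) \<Longrightarrow> x \<in> carrier_vec (nverts G) \<Longrightarrow>
    shifted_char G k x \<in> carrier_vec (nverts G)"
  by (simp add: shifted_char_def)

lemma shifted_char_eq:
  assumes "k \<in> carrier_vec (nverts G)" "x \<in> carrier_vec (nverts G)"
  shows "shifted_char G k x = 2 \<cdot>\<^sub>v (plumbing_mat G *\<^sub>v x) + (k - plumbing_mat G *\<^sub>v ones G)"
  unfolding shifted_char_def
  using assms plumbing_mat_mult_carrier[OF assms(2)] plumbing_mat_mult_carrier[OF ones_carrier, of G]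
  by (intro eq_vecI) (auto simp del: index_mult_mat_vec)

lemma chars_carrier: "k \<in> chars G \<Longrightarrow> k \<in> carrier_vec (nverts G)"
  by (auto simp: chars_def nverts_def)

lemma even_symmetric_sum:
  fixes A :: "nat \<Rightarrow> nat \<Rightarrow> int"
  assumes "\<And>i j. i < n \<Longrightarrow> j < n \<Longrightarrow> A i j = A j i"
  shows "even ((\<Sum>i<n. \<Sum>j<n. A i j) - (\<Sum>i<n. A i i))"
  using assms
proof (induction n)
  case (Suc n)
  have "(\<Sum>i<n. A i n) = (\<Sum>j<n. A n j)"
    using Suc.prems by (intro sum.cong) auto
  then have "(\<Sum>i<Suc n. \<Sum>j<Suc n. A i j) - (\<Sum>i<Suc n. A i i)
    = ((\<Sum>i<n. \<Sum>j<n. A i j) - (\<Sum>i<n. A i i)) + 2 * (\<Sum>j<n. A n j)"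
    by (simp add: sum.distrib)
  then show ?case
    using Suc.IH Suc.prems by simp
qed simp

text \<open>Modulo 2, a symmetric sum reduces to its diagonal, and \<open>k\<close> agrees with the diagonal of \<open>M\<close>.
  Hence the divisions by 2 in the definitions of \<open>chi\<close> and \<open>Theta\<close> are exact.\<close>

lemma even_chars_pairing:
  assumes "k \<in> chars G" "x \<in> carrier_vec (nverts G)"
  shows "even (k \<bullet> x + pairing G x x)"
proof -
  let ?A = "\<lambda>i j. x $ i * plumbing_mat G $$ (i, j) * x $ j"
  obtain y where y: "y \<in> carrier_vec (nverts G)" "k = weights G + 2 \<cdot>\<^sub>v y"
    using assms(1) by (auto simp: chars_def)
  have "pairing G x x = (\<Sum>i<nverts G. \<Sum>j<nverts G. ?A i j)"
    unfolding pairing_def using form_sum[OF assms(2) assms(2)] by (simp add: form_mat_int)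
  then have "k \<bullet> x + pairing G x x = (k \<bullet> x + (\<Sum>i<nverts G. ?A i i))
      + ((\<Sum>i<nverts G. \<Sum>j<nverts G. ?A i j) - (\<Sum>i<nverts G. ?A i i))"
    by simp
  moreover have "even ((\<Sum>i<nverts G. \<Sum>j<nverts G. ?A i j) - (\<Sum>i<nverts G. ?A i i))"
    by (rule even_symmetric_sum) (auto simp: plumbing_mat_sym[of _ G] mult_ac)
  moreover have "k \<bullet> x + (\<Sum>i<nverts G. ?A i i)
    = (\<Sum>i<nverts G. weights G $ i * (x $ i * (x $ i + 1)) + 2 * (y $ i * x $ i))"
    using y by (simp add: scalar_prod_sum[OF assms(2)] sum.distrib[symmetric] plumbing_mat_diag
        nverts_def algebra_simps)
  moreover have "even \<dots>"
    by (intro dvd_sum) auto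
  ultimately show ?thesis
    by (simp only: dvd_add)
qed

text \<open>Completing the square.\<close>

lemma inverse_square_translate:
  assumes G: "negative_definite G" and b: "b \<in> carrier_vec (nverts G)" and x: "x \<in> carrier_vec (nverts G)"
  shows "inverse_square G (2 \<cdot>\<^sub>v (plumbing_mat G *\<^sub>v x) + b)
    = 4 * of_int (pairing G x x + b \<bullet> x) + inverse_square G b"
proof -
  let ?A = "form_mat G :: rat mat" and ?X = "map_vec rat_of_int x"
  obtain z where z: "z \<in> carrier_vec (nverts G)" "?A *\<^sub>v z = map_vec rat_of_int b"
    using inverse_square_preimage[OF G b] .
  have X: "?X \<in> carrier_vec (nverts G)" using x by simp
  have AX: "?A *\<^sub>v ?X = map_vec rat_of_int (plumbing_mat G *\<^sub>v x)"
    by (rule of_int_form_mat[OF x, symmetric])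
  have pre: "?A *\<^sub>v (2 \<cdot>\<^sub>v ?X + z) = map_vec rat_of_int (2 \<cdot>\<^sub>v (plumbing_mat G *\<^sub>v x) + b)"
    using X z b x plumbing_mat_mult_carrier[OF x]
    by (subst form_mat_add, simp, simp, simp only: form_mat_smult AX z(2))
      (auto intro!: eq_vecI simp del: index_mult_mat_vec)
  have "inverse_square G (2 \<cdot>\<^sub>v (plumbing_mat G *\<^sub>v x) + b)
    = (2 \<cdot>\<^sub>v ?X + z) \<bullet> (?A *\<^sub>v (2 \<cdot>\<^sub>v ?X + z))"
    using X z(1) b x by (intro negative_definite_form_eq[OF G _ pre]) auto
  also have "\<dots> = 4 * (?X \<bullet> (?A *\<^sub>v ?X)) + 4 * (?X \<bullet> (?A *\<^sub>v z)) + z \<bullet> (?A *\<^sub>v z)"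
    by (subst form_combination[OF X z(1)]) simp
  also have "z \<bullet> (?A *\<^sub>v z) = inverse_square G b"
    using negative_definite_form_eq[OF G z b] by simp
  also have "?X \<bullet> (?A *\<^sub>v ?X) = of_int (pairing G x x)"
    unfolding AX pairing_def using x by (simp add: of_int_scalar_prod[of _ "nverts G"])
  also have "?X \<bullet> (?A *\<^sub>v z) = of_int (b \<bullet> x)"
    unfolding z(2) using x b comm_scalar_prod[OF b x] by (simp add: of_int_scalar_prod[of _ "nverts G"])
  finally show ?thesis
    by simp
qed

lemma epsilon_eq:
  assumes G: "negative_definite G" and k: "k \<in> chars G" and x: "x \<in> carrier_vec (nverts G)"
  shows "epsilon G k x = energy G (shifted_char G k x)"
proof -
  let ?u = "plumbing_mat G *\<^sub>v ones G"
  have kc: "k \<in> carrier_vec (nverts G)" using chars_carrier[OF k] .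
  have u: "?u \<in> carrier_vec (nverts G)" by simp
  have "(k - ?u) \<bullet> x = k \<bullet> x - pairing G x (ones G)"
    unfolding pairing_def using minus_scalar_prod_distrib[OF kc u x] comm_scalar_prod[OF u x] by simp
  then have "inverse_square G (shifted_char G k x)
    = 4 * of_int (pairing G x x + k \<bullet> x - pairing G x (ones G)) + inverse_square G (k - ?u)"
    using inverse_square_translate[OF G _ x, of "k - ?u"] kc u shifted_char_eq[OF kc x] by simp
  moreover have "2 * chi G k x = - (k \<bullet> x + pairing G x x)"
    using even_chars_pairing[OF k x] unfolding chi_def by (intro dvd_mult_div_cancel) simp
  ultimately show ?thesis
    unfolding epsilon_def Delta_eq energy_def by (simp add: field_simps)
qed

lemma theta_eq:
  assumes k: "k \<in> chars G" and x: "x \<in> carrier_vec (nverts G)"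
  shows "2 * theta G k x = shifted_char G k x \<bullet> ones G"
proof -
  let ?u = "plumbing_mat G *\<^sub>v ones G"
  have kc: "k \<in> carrier_vec (nverts G)" using chars_carrier[OF k] .
  have u: "?u \<in> carrier_vec (nverts G)" by simp
  have "(plumbing_mat G *\<^sub>v x) \<bullet> ones G = pairing G x (ones G)"
    using form_sym[OF x ones_carrier] x comm_scalar_prod[of "plumbing_mat G *\<^sub>v x" "nverts G" "ones G"]
    by (simp add: form_mat_int pairing_def)
  moreover have "?u \<bullet> ones G = pairing G (ones G) (ones G)"
    using comm_scalar_prod[OF u ones_carrier] by (simp add: pairing_def)
  ultimately have "shifted_char G k x \<bullet> ones G
    = 2 * pairing G x (ones G) + (k \<bullet> ones G - pairing G (ones G) (ones G))"
    unfolding shifted_char_eq[OF kc x]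
    using kc x u plumbing_mat_mult_carrier[OF x]
    by (simp add: smult_scalar_prod_distrib[of _ "nverts G"] add_scalar_prod_distrib[of _ "nverts G"] minus_scalar_prod_distrib[of _ "nverts G"])
  moreover have "even (k \<bullet> ones G - pairing G (ones G) (ones G))"
    using even_chars_pairing[OF k ones_carrier] by simp
  then have "2 * Theta G k = k \<bullet> ones G - pairing G (ones G) (ones G)"
    unfolding Theta_def by (intro dvd_mult_div_cancel)
  ultimately show ?thesis
    by (simp add: theta_def)
qed

section \<open>Finiteness\<close>

lemma shifted_inj:
  assumes G: "negative_definite G" and b: "b \<in> carrier_vec (nverts G)"
  shows "inj_on (\<lambda>x. 2 \<cdot>\<^sub>v (plumbing_mat G *\<^sub>v x) + b) (carrier_vec (nverts G))"
proof (rule inj_onI)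
  fix x y assume x: "x \<in> carrier_vec (nverts G)" and y: "y \<in> carrier_vec (nverts G)"
    and eq: "2 \<cdot>\<^sub>v (plumbing_mat G *\<^sub>v x) + b = 2 \<cdot>\<^sub>v (plumbing_mat G *\<^sub>v y) + b"
  obtain B where B: "B \<in> carrier_mat (nverts G) (nverts G)" "B * form_mat G = (1\<^sub>m (nverts G) :: rat mat)"
    using negative_definite_inverse[OF G] by metis
  have inv: "B *\<^sub>v map_vec rat_of_int (plumbing_mat G *\<^sub>v v) = map_vec rat_of_int v"
    if "v \<in> carrier_vec (nverts G)" for v
  proof -
    have V: "map_vec rat_of_int v \<in> carrier_vec (nverts G)" using that by simp
    show ?thesis
      using assoc_mult_mat_vec[OF B(1) form_mat_carrier V] B(2) V of_int_form_mat[OF that, where 'a = rat]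
      by simp
  qed
  have "plumbing_mat G *\<^sub>v x = plumbing_mat G *\<^sub>v y"
  proof (rule eq_vecI)
    fix i assume "i < dim_vec (plumbing_mat G *\<^sub>v y)"
    then have i: "i < nverts G" by simp
    have "(2 \<cdot>\<^sub>v (plumbing_mat G *\<^sub>v x) + b) $ i = (2 \<cdot>\<^sub>v (plumbing_mat G *\<^sub>v y) + b) $ i"
      using eq by simp
    then show "(plumbing_mat G *\<^sub>v x) $ i = (plumbing_mat G *\<^sub>v y) $ i"
      using i b by (simp del: index_mult_mat_vec)
  qed simp
  then have "map_vec rat_of_int x = map_vec rat_of_int y"
    using inv[OF x] inv[OF y] by simp
  then show "x = y"
    using of_int_hom.vec_hom_inj by blast
qed

lemma shifted_char_inj:
  assumes "negative_definite G" "k \<in> carrier_vec (nverts G)"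
  shows "inj_on (shifted_char G k) (carrier_vec (nverts G))"
proof -
  have "k - plumbing_mat G *\<^sub>v ones G \<in> carrier_vec (nverts G)"
    using assms(2) by simp
  from shifted_inj[OF assms(1) this] show ?thesis
    by (rule inj_on_cong[THEN iffD1, rotated]) (simp add: shifted_char_eq[OF assms(2)])
qed

lemma finite_chi_le:
  assumes G: "negative_definite G" and k: "k \<in> chars G"
  shows "finite {x \<in> carrier_vec (nverts G). chi G k x \<le> n}"
proof (rule inj_on_finite)
  have kc: "k \<in> carrier_vec (nverts G)" using chars_carrier[OF k] .
  show "inj_on (\<lambda>x. 2 \<cdot>\<^sub>v (plumbing_mat G *\<^sub>v x) + k) {x \<in> carrier_vec (nverts G). chi G k x \<le> n}"
    by (rule inj_on_subset[OF shifted_inj[OF G kc]]) auto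
  let ?B = "inverse_square G k - 8 * of_int n"
  show "finite {w \<in> carrier_vec (nverts G). ?B \<le> inverse_square G w}"
    by (rule finite_inverse_square_ge[OF G])
  show "(\<lambda>x. 2 \<cdot>\<^sub>v (plumbing_mat G *\<^sub>v x) + k) ` {x \<in> carrier_vec (nverts G). chi G k x \<le> n}
    \<subseteq> {w \<in> carrier_vec (nverts G). ?B \<le> inverse_square G w}"
  proof safe
    fix x assume x: "x \<in> carrier_vec (nverts G)" "chi G k x \<le> n"
    show "2 \<cdot>\<^sub>v (plumbing_mat G *\<^sub>v x) + k \<in> carrier_vec (nverts G)"
      using x kc by simp
    have "2 * chi G k x = - (k \<bullet> x + pairing G x x)"
      using even_chars_pairing[OF k x(1)] unfolding chi_def by (intro dvd_mult_div_cancel) simp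
    then have "- 2 * n \<le> pairing G x x + k \<bullet> x" using x(2) by simp
    then have "rat_of_int (- 2 * n) \<le> of_int (pairing G x x + k \<bullet> x)"
      unfolding of_int_le_iff .
    then show "?B \<le> inverse_square G (2 \<cdot>\<^sub>v (plumbing_mat G *\<^sub>v x) + k)"
      unfolding inverse_square_translate[OF G kc x(1)] by simp
  qed
qed

lemma finite_energy_le:
  assumes "negative_definite G"
  shows "finite {w \<in> carrier_vec (nverts G). energy G w \<le> a}"
proof (rule finite_subset[OF _ finite_inverse_square_ge[OF assms]])
  show "{w \<in> carrier_vec (nverts G). energy G w \<le> a} \<subseteq> {w \<in> carrier_vec (nverts G).
    - (4 * a) - 3 * of_nat (nverts G) - of_int (\<Sum>i<nverts G. weights G $ i) \<le> inverse_square G w}"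
    by (auto simp: energy_def)
qed

section \<open>The coefficients of the limit\<close>

text \<open>The coefficient of \<open>q\<^sup>a t\<^sup>j\<close> in the limit is a sum over the vectors \<open>w = c - Mu\<close>,
  where \<open>c\<close> runs through the spin-c structure. The exponents are read off from \<open>w\<close>; the
  exponent of \<open>t\<close> is half the sum of the entries.\<close>

definition exponent_fibre :: "plumbing \<Rightarrow> int vec set \<Rightarrow> rat \<Rightarrow> int \<Rightarrow> int vec set" where
  "exponent_fibre G S a j =
     {w \<in> (\<lambda>c. c - plumbing_mat G *\<^sub>v ones G) ` S. energy G w = a \<and> w \<bullet> ones G = 2 * j}"

definition limit_coeff :: "(nat \<Rightarrow> int \<Rightarrow> 'r :: {comm_ring, comm_monoid_mult}) \<Rightarrow>
    plumbing \<Rightarrow> int vec set \<Rightarrow> rat \<Rightarrow> int \<Rightarrow> 'r" where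
  "limit_coeff F G S a j = (\<Sum>w \<in> exponent_fibre G S a j. vertex_weight F G w)"

lemma spinc_carrier: "k \<in> carrier_vec (nverts G) \<Longrightarrow> spinc G k \<subseteq> carrier_vec (nverts G)"
  by (auto simp: spinc_def)

lemma shift_spinc:
  assumes "k \<in> carrier_vec (nverts G)"
  shows "(\<lambda>c. c - plumbing_mat G *\<^sub>v ones G) ` spinc G k = shifted_char G k ` carrier_vec (nverts G)"
proof -
  have "k + 2 \<cdot>\<^sub>v (plumbing_mat G *\<^sub>v y) - plumbing_mat G *\<^sub>v ones G = shifted_char G k y"
    if "y \<in> carrier_vec (nverts G)" for y
    unfolding shifted_char_def
    using assms plumbing_mat_mult_carrier[OF that] comm_add_vec[of k "nverts G"] by simp
  then show ?thesis
    unfolding spinc_def by (force simp: image_iff)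
qed

lemma finite_exponent_fibre:
  assumes "negative_definite G" "S \<subseteq> carrier_vec (nverts G)"
  shows "finite (exponent_fibre G S a j)"
  by (rule finite_subset[OF _ finite_energy_le[OF assms(1), of a]])
    (use assms(2) in \<open>auto simp: exponent_fibre_def\<close>)

lemma exponent_fibre_spinc:
  assumes "negative_definite G" "k \<in> chars G"
  shows "exponent_fibre G (spinc G k) a j
    = shifted_char G k ` {x \<in> carrier_vec (nverts G). epsilon G k x = a \<and> theta G k x = j}"
proof -
  have "shifted_char G k x \<bullet> ones G = 2 * j \<longleftrightarrow> theta G k x = j" if "x \<in> carrier_vec (nverts G)" for x
    using theta_eq[OF assms(2) that] by linarith
  then show ?thesis
    unfolding exponent_fibre_def shift_spinc[OF chars_carrier[OF assms(2)]]
    using epsilon_eq[OF assms] by auto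
qed

text \<open>The finitely many lattice points with the prescribed exponents all enter the sum as soon as
  the bound on \<open>chi\<close> exceeds their values of \<open>chi\<close>; the other points do not contribute.\<close>

lemma eventually_lookup_P_seq:
  fixes F :: "nat \<Rightarrow> int \<Rightarrow> 'r :: {comm_ring, comm_monoid_mult}"
  assumes G: "negative_definite G" and k: "k \<in> chars G"
  shows "\<forall>\<^sub>F n in sequentially.
    Poly_Mapping.lookup (P_seq F G k n0 n) (a, j) = limit_coeff F G (spinc G k) a j"
proof -
  have kc: "k \<in> carrier_vec (nverts G)" using chars_carrier[OF k] .
  let ?E = "{x \<in> carrier_vec (nverts G). epsilon G k x = a \<and> theta G k x = j}"
  have inj: "inj_on (shifted_char G k) ?E"
    by (rule inj_on_subset[OF shifted_char_inj[OF G kc]]) auto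
  have fin: "finite ?E"
    using finite_exponent_fibre[OF G spinc_carrier[OF kc], of a j] inj
    unfolding exponent_fibre_spinc[OF G k] by (rule finite_imageD)
  have coeff: "limit_coeff F G (spinc G k) a j = (\<Sum>x\<in>?E. F_weight F G k x)"
    unfolding limit_coeff_def exponent_fibre_spinc[OF G k] sum.reindex[OF inj]
    by (simp add: F_weight_eq)
  define N where "N = Max (chi G k ` ?E)"
  have N: "chi G k x \<le> N" if "x \<in> ?E" for x
    unfolding N_def using fin that by (intro Max_ge finite_imageI imageI)
  show ?thesis
    unfolding eventually_sequentially
  proof (intro exI allI impI)
    fix n assume n: "nat (N - n0) \<le> n"
    let ?X = "{x \<in> carrier_vec (nverts G). chi G k x \<le> n0 + int n}"
    have "Poly_Mapping.lookup (P_seq F G k n0 n) (a, j)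
      = (\<Sum>x\<in>?X. if epsilon G k x = a \<and> theta G k x = j then F_weight F G k x else 0)"
      unfolding P_seq_def P_poly_def lookup_sum lookup_single when_def by simp
    also have "\<dots> = (\<Sum>x\<in>{x \<in> ?X. epsilon G k x = a \<and> theta G k x = j}. F_weight F G k x)"
      by (rule sum.inter_filter[OF finite_chi_le[OF G k], symmetric])
    also have "{x \<in> ?X. epsilon G k x = a \<and> theta G k x = j} = ?E"
    proof -
      have "chi G k x \<le> n0 + int n" if "x \<in> ?E" for x
        using N[OF that] n by linarith
      then show ?thesis by auto
    qed
    finally show "Poly_Mapping.lookup (P_seq F G k n0 n) (a, j) = limit_coeff F G (spinc G k) a j"
      unfolding coeff .
  qed
qed

lemma P_infty_eq:
  assumes "negative_definite G" "k \<in> chars G"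
  shows "P_infty F G k n0 = limit_coeff F G (spinc G k)"
proof (intro ext)
  fix a j
  let ?c = "limit_coeff F G (spinc G k) a j"
  note ev = eventually_lookup_P_seq[OF assms, of F n0 a j]
  show "P_infty F G k n0 a j = ?c"
    unfolding P_infty_def stable_limit_def
  proof (rule the_equality, rule ev)
    fix c assume "\<forall>\<^sub>F n in sequentially. Poly_Mapping.lookup (P_seq F G k n0 n) (a, j) = c"
    with ev have "\<forall>\<^sub>F n in sequentially. c = ?c"
      by eventually_elim simp
    then show "c = ?c" by simp
  qed
qed

lemma stabilizes_P_seq:
  assumes "negative_definite G" "k \<in> chars G"
  shows "stabilizes (Delta G k) (P_seq F G k n0)"
  unfolding stabilizes_def
proof (intro conjI allI)
  fix n
  have "a - Delta G k \<in> \<int>" if "(a, j) \<in> Poly_Mapping.keys (P_seq F G k n0 n)" for a j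
  proof -
    have "Poly_Mapping.lookup (P_seq F G k n0 n) (a, j) \<noteq> 0"
      using that by (simp add: in_keys_iff)
    then obtain x where "(F_weight F G k x when (epsilon G k x, theta G k x) = (a, j)) \<noteq> 0"
      unfolding P_seq_def P_poly_def lookup_sum lookup_single by (rule sum.not_neutral_contains_not_neutral)
    then have "epsilon G k x = a" by (auto simp: when_def split: if_splits)
    then have "a - Delta G k = of_int (2 * chi G k x + pairing G x (ones G))"
      by (auto simp: epsilon_def)
    then show ?thesis by (metis Ints_of_int)
  qed
  then show "P_seq F G k n0 n \<in> shifted_laurent_polys (Delta G k)"
    by (auto simp: shifted_laurent_polys_def)
next
  fix i j
  show "\<exists>c. \<forall>\<^sub>F n in sequentially. Poly_Mapping.lookup (P_seq F G k n0 n) (Delta G k + of_int i, j) = c"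
    by (rule exI, rule eventually_lookup_P_seq[OF assms])
qed

lemma limit_coeff_nonzero:
  assumes "limit_coeff F G S a j \<noteq> 0"
  obtains w where "w \<in> exponent_fibre G S a j"
  using assms unfolding limit_coeff_def by (rule sum.not_neutral_contains_not_neutral)

text \<open>For a fixed exponent of \<open>q\<close> only finitely many vectors contribute, hence only finitely
  many powers of \<open>t\<close>; and \<open>w\<^sup>2 \<le> 0\<close> bounds the exponents of \<open>q\<close> from below.\<close>

lemma limit_coeff_laurent:
  fixes F :: "nat \<Rightarrow> int \<Rightarrow> 'r :: {comm_ring, comm_monoid_mult}"
  assumes G: "negative_definite G" and k: "k \<in> chars G"
  shows "limit_coeff F G (spinc G k) \<in> shifted_laurent_series (Delta G k)"
proof -
  have kc: "k \<in> carrier_vec (nverts G)" using chars_carrier[OF k] .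
  let ?L = "limit_coeff F G (spinc G k)" and ?D = "Delta G k"
  let ?low = "- (3 * of_nat (nverts G) + of_int (\<Sum>i<nverts G. weights G $ i)) / (4 :: rat)"
  have fibre: "w \<in> carrier_vec (nverts G) \<and> energy G w = a \<and> w \<bullet> ones G = 2 * j"
    if "w \<in> exponent_fibre G (spinc G k) a j" for w a j
    using that spinc_carrier[OF kc] by (auto simp: exponent_fibre_def)
  have low: "?low \<le> a" if "?L a j \<noteq> 0" for a j
  proof -
    from that obtain w where "w \<in> exponent_fibre G (spinc G k) a j"
      by (rule limit_coeff_nonzero)
    then have "w \<in> carrier_vec (nverts G)" "energy G w = a" using fibre by auto
    with inverse_square_nonpos[OF G this(1)] show ?thesis
      by (auto simp: energy_def)
  qed
  have integral: "a - ?D \<in> \<int>" if "?L a j \<noteq> 0" for a j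
  proof -
    from that obtain w where "w \<in> exponent_fibre G (spinc G k) a j"
      by (rule limit_coeff_nonzero)
    then obtain x where "epsilon G k x = a"
      unfolding exponent_fibre_spinc[OF G k] by auto
    then have "a - ?D = of_int (2 * chi G k x + pairing G x (ones G))"
      by (auto simp: epsilon_def)
    then show ?thesis by (metis Ints_of_int)
  qed
  have fin: "finite {j. ?L a j \<noteq> 0}" for a
  proof (rule finite_subset)
    show "finite ((\<lambda>w. w \<bullet> ones G div 2) ` {w \<in> carrier_vec (nverts G). energy G w \<le> a})"
      using finite_energy_le[OF G] by simp
    show "{j. ?L a j \<noteq> 0} \<subseteq> (\<lambda>w. w \<bullet> ones G div 2) ` {w \<in> carrier_vec (nverts G). energy G w \<le> a}"
    proof safe
      fix j assume "?L a j \<noteq> 0"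
      then obtain w where "w \<in> exponent_fibre G (spinc G k) a j"
        by (rule limit_coeff_nonzero)
      then show "j \<in> (\<lambda>w. w \<bullet> ones G div 2) ` {w \<in> carrier_vec (nverts G). energy G w \<le> a}"
        using fibre by (force simp: image_iff)
    qed
  qed
  define h where "h i = Abs_poly_mapping (?L (?D + of_int i))" for i :: int
  have h: "Poly_Mapping.lookup (h i) = ?L (?D + of_int i)" for i
    unfolding h_def by (rule lookup_Abs_poly_mapping[OF fin])
  have h0: "h i = 0" if "i < \<lfloor>?low - ?D\<rfloor>" for i
  proof (rule poly_mapping_eqI)
    fix j
    have "of_int i < ?low - ?D" using that by linarith
    then show "Poly_Mapping.lookup (h i) j = Poly_Mapping.lookup 0 j"
      using low[of "?D + of_int i" j] unfolding h by (auto simp: algebra_simps)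
  qed
  have nth: "fls_nth (Abs_fls h) = h"
    by (rule ext, rule nth_Abs_fls_ex_lower_bound) (use h0 in blast)
  show ?thesis
    unfolding shifted_laurent_series_def
  proof (intro CollectI exI allI)
    fix a j
    show "?L a j = (if a - ?D \<in> \<int> then Poly_Mapping.lookup (fls_nth (Abs_fls h) \<lfloor>a - ?D\<rfloor>) j else 0)"
      using integral[of a j] unfolding nth h by (auto elim!: Ints_cases)
  qed
qed

lemma spinc_subset:
  assumes k: "k \<in> carrier_vec (nverts G)" and k': "k' \<in> spinc G k"
  shows "spinc G k' \<subseteq> spinc G k"
proof
  fix c assume "c \<in> spinc G k'"
  then obtain v where v: "v \<in> carrier_vec (nverts G)" "c = k' + 2 \<cdot>\<^sub>v (plumbing_mat G *\<^sub>v v)"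
    by (auto simp: spinc_def)
  obtain y where y: "y \<in> carrier_vec (nverts G)" "k' = k + 2 \<cdot>\<^sub>v (plumbing_mat G *\<^sub>v y)"
    using k' by (auto simp: spinc_def)
  have "c = k + 2 \<cdot>\<^sub>v (plumbing_mat G *\<^sub>v (y + v))"
    unfolding v(2) y(2) mult_add_distrib_mat_vec[OF plumbing_mat_carrier y(1) v(1)]
    using k plumbing_mat_mult_carrier[OF y(1)] plumbing_mat_mult_carrier[OF v(1)]
    by (simp add: smult_add_distrib_vec[of _ "nverts G"] assoc_add_vec[of _ "nverts G"])
  moreover have "y + v \<in> carrier_vec (nverts G)"
    using y(1) v(1) by simp
  ultimately show "c \<in> spinc G k"
    unfolding spinc_def by blast
qed

lemma spinc_eq:
  assumes k: "k \<in> carrier_vec (nverts G)" and k': "k' \<in> spinc G k"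
  shows "spinc G k' = spinc G k"
proof
  show "spinc G k' \<subseteq> spinc G k" by (rule spinc_subset[OF assms])
  obtain y where y: "y \<in> carrier_vec (nverts G)" "k' = k + 2 \<cdot>\<^sub>v (plumbing_mat G *\<^sub>v y)"
    using k' by (auto simp: spinc_def)
  have My: "plumbing_mat G *\<^sub>v y \<in> carrier_vec (nverts G)"
    using y(1) by simp
  have "plumbing_mat G *\<^sub>v (y + - y) = plumbing_mat G *\<^sub>v y + plumbing_mat G *\<^sub>v (- y)"
    using mult_add_distrib_mat_vec[OF plumbing_mat_carrier y(1), of "- y"] y(1) by simp
  have "k = k' + 2 \<cdot>\<^sub>v (plumbing_mat G *\<^sub>v (- y))"
    unfolding y(2) using k My y(1) by (intro eq_vecI) auto
  moreover have "- y \<in> carrier_vec (nverts G)"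
    using y(1) by simp
  ultimately have "k \<in> spinc G k'"
    unfolding spinc_def by blast
  moreover have "k' \<in> carrier_vec (nverts G)"
    using k' spinc_carrier[OF k] by blast
  ultimately show "spinc G k \<subseteq> spinc G k'"
    by (intro spinc_subset)
qed

lemma spinc_subset_chars:
  assumes k: "k \<in> chars G"
  shows "spinc G k \<subseteq> chars G"
proof
  fix c assume "c \<in> spinc G k"
  then obtain y where y: "y \<in> carrier_vec (nverts G)" "c = k + 2 \<cdot>\<^sub>v (plumbing_mat G *\<^sub>v y)"
    by (auto simp: spinc_def)
  obtain z where z: "z \<in> carrier_vec (nverts G)" "k = weights G + 2 \<cdot>\<^sub>v z"
    using k by (auto simp: chars_def)
  have w: "weights G \<in> carrier_vec (nverts G)" by (auto simp: nverts_def)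
  have "c = weights G + 2 \<cdot>\<^sub>v (z + plumbing_mat G *\<^sub>v y)"
    unfolding y(2) z(2) using w z(1) plumbing_mat_mult_carrier[OF y(1)]
    by (simp add: smult_add_distrib_vec[of _ "nverts G"] assoc_add_vec[of _ "nverts G"])
  moreover have "z + plumbing_mat G *\<^sub>v y \<in> carrier_vec (nverts G)"
    using y(1) z(1) by simp
  ultimately show "c \<in> chars G"
    unfolding chars_def by blast
qed

section \<open>Blowing up the form\<close>

text \<open>The indicator vector of \<open>A\<close>, with entries in an arbitrary ring.\<close>

definition indicator_vec :: "nat \<Rightarrow> nat set \<Rightarrow> 'a :: comm_ring_1 vec" where
  "indicator_vec n A = vec n (\<lambda>i. if i \<in> A then 1 else 0)"

lemma indicator_vec_carrier [simp]: "indicator_vec n A \<in> carrier_vec n"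
  by (simp add: indicator_vec_def)

lemma dim_indicator_vec [simp]: "dim_vec (indicator_vec n A) = n"
  by (simp add: indicator_vec_def)

lemma indicator_vec_index [simp]: "i < n \<Longrightarrow> indicator_vec n A $ i = (if i \<in> A then 1 else 0)"
  by (simp add: indicator_vec_def)

text \<open>Both moves change the form in the same way: a new vertex of weight \<open>-1\<close> is joined to the
  vertices in \<open>A\<close>, and the all-ones matrix is subtracted on \<open>A \<times> A\<close>. For type (a) the set \<open>A\<close>
  consists of the two ends of the edge, for type (b) of one vertex.\<close>

locale blow_up =
  fixes G G' :: plumbing and A :: "nat set"
  assumes A: "A \<subseteq> {..<nverts G}"
    and nverts': "nverts G' = Suc (nverts G)"
    and mat_00: "plumbing_mat G' $$ (0, 0) = - 1"
    and mat_0_Suc: "\<And>j. j < nverts G \<Longrightarrow> plumbing_mat G' $$ (0, Suc j) = (if j \<in> A then 1 else 0)"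
    and mat_Suc_Suc: "\<And>i j. i < nverts G \<Longrightarrow> j < nverts G \<Longrightarrow>
      plumbing_mat G' $$ (Suc i, Suc j) = plumbing_mat G $$ (i, j) - (if i \<in> A \<and> j \<in> A then 1 else 0)"
begin

abbreviation n where "n \<equiv> nverts G"

abbreviation ind :: "'a :: comm_ring_1 vec" where "ind \<equiv> indicator_vec (nverts G) A"

lemma mat_Suc_0: "i < n \<Longrightarrow> plumbing_mat G' $$ (Suc i, 0) = (if i \<in> A then 1 else 0)"
  using plumbing_mat_sym[of "Suc i" G' 0] mat_0_Suc[of i] nverts' by simp

lemma form_mat_blow_up:
  fixes x :: "'a :: comm_ring_1 vec"
  assumes x: "x \<in> carrier_vec n"
  shows "form_mat G' *\<^sub>v vCons x0 x
    = vCons (ind \<bullet> x - x0) (form_mat G *\<^sub>v x - (ind \<bullet> x - x0) \<cdot>\<^sub>v ind)"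
proof (rule eq_vecI)
  have x': "vCons x0 x \<in> carrier_vec (nverts G')"
    using x by (simp add: nverts')
  have s: "ind \<bullet> x = (\<Sum>j<n. (if j \<in> A then 1 else 0) * x $ j)"
    by (simp add: scalar_prod_sum[OF x])
  fix i assume "i < dim_vec (vCons (ind \<bullet> x - x0) (form_mat G *\<^sub>v x - (ind \<bullet> x - x0) \<cdot>\<^sub>v ind))"
  then have i: "i < Suc n" by simp
  have expand: "(form_mat G' *\<^sub>v vCons x0 x) $ i = of_int (plumbing_mat G' $$ (i, 0)) * x0
    + (\<Sum>j<n. of_int (plumbing_mat G' $$ (i, Suc j)) * x $ j)"
    using form_mat_mult_index[OF x', of i] i unfolding nverts'
    by (simp add: sum.lessThan_Suc_shift del: sum.lessThan_Suc)
  show "(form_mat G' *\<^sub>v vCons x0 x) $ i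
    = vCons (ind \<bullet> x - x0) (form_mat G *\<^sub>v x - (ind \<bullet> x - x0) \<cdot>\<^sub>v ind) $ i"
  proof (cases i)
    case 0
    have "(\<Sum>j<n. of_int (plumbing_mat G' $$ (0, Suc j)) * x $ j) = ind \<bullet> x"
      unfolding s by (intro sum.cong) (auto simp: mat_0_Suc)
    then show ?thesis
      using expand by (simp add: 0 mat_00)
  next
    case (Suc l)
    then have l: "l < n" using i by simp
    have "(\<Sum>j<n. of_int (plumbing_mat G' $$ (i, Suc j)) * x $ j)
      = (\<Sum>j<n. of_int (plumbing_mat G $$ (l, j)) * x $ j
          - (if l \<in> A then 1 else 0) * ((if j \<in> A then 1 else 0) * x $ j))"
      unfolding Suc by (intro sum.cong) (auto simp: mat_Suc_Suc l algebra_simps)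
    also have "\<dots> = (form_mat G *\<^sub>v x) $ l - (if l \<in> A then 1 else 0) * (ind \<bullet> x)"
      unfolding form_mat_mult_index[OF x l] s by (simp add: sum_subtractf sum_distrib_left)
    finally have "(\<Sum>j<n. of_int (plumbing_mat G' $$ (i, Suc j)) * x $ j)
      = (form_mat G *\<^sub>v x) $ l - (if l \<in> A then 1 else 0) * (ind \<bullet> x)" .
    then have "(form_mat G' *\<^sub>v vCons x0 x) $ i = (form_mat G *\<^sub>v x) $ l
      - (if l \<in> A then 1 else 0) * (ind \<bullet> x - x0)"
      unfolding expand by (simp add: Suc mat_Suc_0 l)
    then show ?thesis
      by (simp add: Suc l del: index_mult_mat_vec)
  qed
qed (simp add: nverts')

lemma form_blow_up:
  fixes x :: "'a :: comm_ring_1 vec"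
  assumes x: "x \<in> carrier_vec n"
  shows "vCons x0 x \<bullet> (form_mat G' *\<^sub>v vCons x0 x) = x \<bullet> (form_mat G *\<^sub>v x) - (ind \<bullet> x - x0)\<^sup>2"
proof -
  have "x \<bullet> ind = ind \<bullet> x"
    by (rule comm_scalar_prod[OF x]) simp
  then have "x \<bullet> (form_mat G *\<^sub>v x - (ind \<bullet> x - x0) \<cdot>\<^sub>v ind)
    = x \<bullet> (form_mat G *\<^sub>v x) - (ind \<bullet> x - x0) * (ind \<bullet> x)"
    using x by (subst scalar_prod_minus_distrib[of _ n]) (auto simp: scalar_prod_smult_distrib[of _ n])
  then show ?thesis
    unfolding form_mat_blow_up[OF x] by (simp add: power2_eq_square algebra_simps)
qed

lemma negative_definite_blow_up: "negative_definite G' \<longleftrightarrow> negative_definite G"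
proof
  assume G': "negative_definite G'"
  show "negative_definite G"
    unfolding negative_definite_iff
  proof (intro ballI impI)
    fix v :: "real vec" assume v: "v \<in> carrier_vec n" "v \<noteq> 0\<^sub>v n"
    \<comment> \<open>the new coordinate is chosen such that the subtracted square vanishes\<close>
    have "vCons (ind \<bullet> v) v \<in> carrier_vec (nverts G')" "vCons (ind \<bullet> v) v \<noteq> 0\<^sub>v (nverts G')"
      using v by (auto simp: nverts' zero_vec_Suc)
    then have "vCons (ind \<bullet> v) v \<bullet> (form_mat G' *\<^sub>v vCons (ind \<bullet> v) v) < 0"
      using G' by (simp add: negative_definite_iff)
    then show "v \<bullet> (form_mat G *\<^sub>v v) < 0"
      unfolding form_blow_up[OF v(1)] by simp
  qed
next
  assume G: "negative_definite G"
  show "negative_definite G'"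
    unfolding negative_definite_iff
  proof (intro ballI impI)
    fix v :: "real vec" assume v: "v \<in> carrier_vec (nverts G')" "v \<noteq> 0\<^sub>v (nverts G')"
    then obtain x0 x where vx: "v = vCons x0 x"
      by (cases v) (auto simp: nverts')
    then have x: "x \<in> carrier_vec n"
      using v(1) by (simp add: nverts')
    show "v \<bullet> (form_mat G' *\<^sub>v v) < 0"
    proof (cases "x = 0\<^sub>v n")
      case True
      then have "x0 \<noteq> 0"
        using v(2) by (auto simp: vx nverts' zero_vec_Suc)
      moreover have "ind \<bullet> x = 0" "x \<bullet> (form_mat G *\<^sub>v x) = 0"
        using True by (simp_all add: form_sum scalar_prod_sum[of _ n])
      ultimately show ?thesis
        unfolding vx form_blow_up[OF x] by simp
    next
      case False
      then have "x \<bullet> (form_mat G *\<^sub>v x) < 0"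
        using G x by (simp add: negative_definite_iff)
      moreover have "0 \<le> (ind \<bullet> x - x0)\<^sup>2" by simp
      ultimately show ?thesis
        unfolding vx form_blow_up[OF x] by linarith
    qed
  qed
qed

text \<open>A vector over \<open>G\<close> together with the entry \<open>d\<close> at the new vertex gives a vector over \<open>G'\<close>.
  All vectors \<open>2M'x' + k' - M'u'\<close> are of this form.\<close>

definition lift :: "int \<Rightarrow> int vec \<Rightarrow> int vec" where
  "lift d w = vCons d (w - d \<cdot>\<^sub>v ind)"

lemma lift_0 [simp]: "lift d w $ 0 = d"
  by (simp add: lift_def)

lemma lift_inj: "inj_on (lift d) (carrier_vec n)"
proof (rule inj_onI)
  fix v w assume v: "v \<in> carrier_vec n" and w: "w \<in> carrier_vec n" and "lift d v = lift d w"
  then have "v - d \<cdot>\<^sub>v ind = w - d \<cdot>\<^sub>v ind" by (simp add: lift_def)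
  then have "(v - d \<cdot>\<^sub>v ind) $ i = (w - d \<cdot>\<^sub>v ind) $ i" for i by simp
  from this have "v $ i = w $ i" if "i < n" for i
    using that v w by (auto dest!: meta_spec[of _ i] split: if_splits)
  then show "v = w" using v w by (intro eq_vecI) auto
qed

lemma inverse_square_lift:
  assumes G: "negative_definite G" and w: "w \<in> carrier_vec n"
  shows "inverse_square G' (lift d w) = inverse_square G w - of_int (d\<^sup>2)"
proof -
  obtain z where z: "z \<in> carrier_vec n" "form_mat G *\<^sub>v z = map_vec rat_of_int w"
    using inverse_square_preimage[OF G w] .
  let ?z = "vCons (ind \<bullet> z - of_int d) z"
  have "form_mat G' *\<^sub>v ?z = map_vec rat_of_int (lift d w)"
    unfolding form_mat_blow_up[OF z(1)] z(2) lift_def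
    using w by (intro eq_vecI) (auto simp: vec_index_vCons)
  then have "inverse_square G' (lift d w) = ?z \<bullet> (form_mat G' *\<^sub>v ?z)"
    using z(1) w negative_definite_blow_up G
    by (intro negative_definite_form_eq) (auto simp: lift_def nverts')
  also have "\<dots> = z \<bullet> (form_mat G *\<^sub>v z) - of_int (d\<^sup>2)"
    unfolding form_blow_up[OF z(1)] by simp
  also have "z \<bullet> (form_mat G *\<^sub>v z) = inverse_square G w"
    using negative_definite_form_eq[OF G z w] by simp
  finally show ?thesis .
qed

lemma sum_indicator: "(\<Sum>i<n. if i \<in> A then 1 else 0 :: int) = int (card A)"
  using A by (simp add: sum.If_cases inf.absorb2)

lemma sum_weights: "(\<Sum>i<nverts G'. weights G' $ i) = (\<Sum>i<n. weights G $ i) - 1 - int (card A)"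
proof -
  have "weights G' $ 0 = - 1"
    using plumbing_mat_diag[of 0 G'] by (simp add: nverts' mat_00)
  moreover have "weights G' $ Suc i = weights G $ i - (if i \<in> A then 1 else 0)" if "i < n" for i
  proof -
    have "weights G' $ Suc i = plumbing_mat G' $$ (Suc i, Suc i)"
      by (rule plumbing_mat_diag[symmetric]) (simp add: nverts' that)
    then show ?thesis
      using that by (simp add: mat_Suc_Suc plumbing_mat_diag)
  qed
  ultimately show ?thesis
    unfolding nverts' sum.lessThan_Suc_shift by (simp add: sum_subtractf sum_indicator)
qed

text \<open>The new vertex contributes \<open>3\<close>, the weights change by \<open>- 1 - card A\<close> in total, and the square
  changes by \<open>- d\<^sup>2\<close>; these cancel for \<open>d = 0\<close> in type (a) and for \<open>d = \<plusminus>1\<close> in type (b).\<close>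

lemma energy_lift:
  assumes "negative_definite G" "w \<in> carrier_vec n" and d: "d\<^sup>2 + int (card A) = 2"
  shows "energy G' (lift d w) = energy G w"
proof -
  have "rat_of_int (int (card A)) = of_int (2 - d\<^sup>2)" using d by (simp only: of_int_eq_iff)
  then show ?thesis
    unfolding energy_def inverse_square_lift[OF assms(1,2)] sum_weights
    unfolding nverts' by simp
qed

lemma ones_blow_up: "ones G' = vCons 1 (ones G)"
  by (rule eq_vecI) (auto simp: ones_def nverts' vec_index_vCons)

lemma indicator_ones: "ind \<bullet> ones G = int (card A)"
  unfolding scalar_prod_sum[OF ones_carrier] sum_indicator[symmetric]
  by (intro sum.cong) (auto simp: ones_def)

lemma lift_ones:
  assumes w: "w \<in> carrier_vec n"
  shows "lift d w \<bullet> ones G' = w \<bullet> ones G + d - d * int (card A)"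
  unfolding lift_def ones_blow_up scalar_prod_vCons
  using w indicator_ones
  by (simp add: minus_scalar_prod_distrib[of _ n] smult_scalar_prod_distrib[of _ n])

text \<open>Both maps \<open>\<alpha>\<close> have the form \<open>k' = (e, k - e g)\<close>, with \<open>e = 1\<close> for type (a) and \<open>e = - 1\<close> for
  type (b).\<close>

lemma shifted_char_blow_up:
  assumes k: "k \<in> carrier_vec n" and x: "x \<in> carrier_vec n"
    and k': "k' = vCons e (k - e \<cdot>\<^sub>v ind)"
  shows "shifted_char G' k' (vCons x0 x)
    = lift (e + 1 - int (card A) + 2 * (ind \<bullet> x - x0)) (shifted_char G k x)"
proof -
  note M = form_mat_blow_up[where 'a = int, unfolded form_mat_int]
  show ?thesis
    unfolding shifted_char_def lift_def k' M[OF x] ones_blow_up M[OF ones_carrier] indicator_ones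
    using k x plumbing_mat_mult_carrier[OF x] plumbing_mat_mult_carrier[OF ones_carrier, of G]
    by (intro eq_vecI) (auto simp: vec_index_vCons algebra_simps simp del: index_mult_mat_vec)
qed

lemma shift_spinc_blow_up:
  assumes k: "k \<in> carrier_vec n" and k': "k' = vCons e (k - e \<cdot>\<^sub>v ind)"
  shows "(\<lambda>c. c - plumbing_mat G' *\<^sub>v ones G') ` spinc G' k'
    = {lift d w |d w. even (d - (e + 1 - int (card A))) \<and>
        w \<in> (\<lambda>c. c - plumbing_mat G *\<^sub>v ones G) ` spinc G k}"
    (is "?L = ?R")
proof -
  have kc': "k' \<in> carrier_vec (nverts G')"
    using k by (simp add: k' nverts')
  show ?thesis
    unfolding shift_spinc[OF k] shift_spinc[OF kc']
  proof safe
    fix x' :: "int vec" assume x': "x' \<in> carrier_vec (nverts G')"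
    then obtain x0 x where xx: "x' = vCons x0 x"
      by (cases x') (auto simp: nverts')
    then have x: "x \<in> carrier_vec n"
      using x' by (simp add: nverts')
    show "\<exists>d w. shifted_char G' k' x' = lift d w \<and> even (d - (e + 1 - int (card A))) \<and>
        w \<in> shifted_char G k ` carrier_vec n"
    proof (intro exI conjI)
      show "shifted_char G' k' x' = lift (e + 1 - int (card A) + 2 * (ind \<bullet> x - x0)) (shifted_char G k x)"
        unfolding xx by (rule shifted_char_blow_up[OF k x k'])
    qed (use x in auto)
  next
    fix d and x :: "int vec"
    assume d: "even (d - (e + 1 - int (card A)))" and x: "x \<in> carrier_vec n"
    define t where "t = (d - (e + 1 - int (card A))) div 2"
    have t: "d = e + 1 - int (card A) + 2 * t"
      using d unfolding t_def by simp
    have "lift d (shifted_char G k x) = shifted_char G' k' (vCons (ind \<bullet> x - t) x)"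
      unfolding shifted_char_blow_up[OF k x k'] t by simp
    then show "lift d (shifted_char G k x) \<in> shifted_char G' k' ` carrier_vec (nverts G')"
      using x by (auto simp: nverts')
  qed
qed

lemma exponent_fibre_blow_up:
  assumes G: "negative_definite G" and k: "k \<in> carrier_vec n" and k': "k' = vCons e (k - e \<cdot>\<^sub>v ind)"
    and d: "d\<^sup>2 + int (card A) = 2" "d * int (card A) = d" "even (d - (e + 1 - int (card A)))"
  shows "{w' \<in> exponent_fibre G' (spinc G' k') a j. w' $ 0 = d} = lift d ` exponent_fibre G (spinc G k) a j"
proof -
  define C where "C = (\<lambda>c. c - plumbing_mat G *\<^sub>v ones G) ` spinc G k"
  have C: "w \<in> carrier_vec n" if "w \<in> C" for w
    using that spinc_carrier[OF k] unfolding C_def by auto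
  have inv: "energy G' (lift d w) = energy G w" "lift d w \<bullet> ones G' = w \<bullet> ones G" if "w \<in> C" for w
    using energy_lift[OF G C[OF that] d(1)] lift_ones[OF C[OF that], of d] d(2) by simp_all
  have C': "w' \<in> (\<lambda>c. c - plumbing_mat G' *\<^sub>v ones G') ` spinc G' k' \<and> w' $ 0 = d \<longleftrightarrow> (\<exists>w\<in>C. w' = lift d w)"
    for w'
  proof
    assume w': "w' \<in> (\<lambda>c. c - plumbing_mat G' *\<^sub>v ones G') ` spinc G' k' \<and> w' $ 0 = d"
    then obtain d' w where w: "w' = lift d' w" "w \<in> C"
      unfolding shift_spinc_blow_up[OF k k', folded C_def] by blast
    with w' have "d' = d" by simp
    with w show "\<exists>w\<in>C. w' = lift d w" by blast
  next
    assume "\<exists>w\<in>C. w' = lift d w"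
    then show "w' \<in> (\<lambda>c. c - plumbing_mat G' *\<^sub>v ones G') ` spinc G' k' \<and> w' $ 0 = d"
      unfolding shift_spinc_blow_up[OF k k', folded C_def] using d(3) by force
  qed
  have "w' \<in> {w' \<in> exponent_fibre G' (spinc G' k') a j. w' $ 0 = d} \<longleftrightarrow>
    (\<exists>w\<in>C. w' = lift d w \<and> energy G' w' = a \<and> w' \<bullet> ones G' = 2 * j)" for w'
    unfolding exponent_fibre_def using C'[of w'] by blast
  then show ?thesis
    unfolding exponent_fibre_def C_def[symmetric] using inv by (auto simp: image_iff)
qed

lemma vertex_weight_blow_up:
  "vertex_weight F G' w' = F (degree_of G' 0) (w' $ 0) * (\<Prod>i<n. F (degree_of G' (Suc i)) (w' $ Suc i))"
  unfolding vertex_weight_def nverts' prod.lessThan_Suc_shift by simp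

lemma sum_lift:
  assumes "negative_definite G" and "k \<in> carrier_vec n" and "k' = vCons e (k - e \<cdot>\<^sub>v ind)"
    and "d\<^sup>2 + int (card A) = 2" "d * int (card A) = d" "even (d - (e + 1 - int (card A)))"
  shows "(\<Sum>w' \<in> {w' \<in> exponent_fibre G' (spinc G' k') a j. w' $ 0 = d}. vertex_weight F G' w')
    = (\<Sum>w \<in> exponent_fibre G (spinc G k) a j. vertex_weight F G' (lift d w))"
proof -
  have "exponent_fibre G (spinc G k) a j \<subseteq> carrier_vec n"
    using spinc_carrier[OF assms(2)] by (auto simp: exponent_fibre_def)
  then have "inj_on (lift d) (exponent_fibre G (spinc G k) a j)"
    by (rule inj_on_subset[OF lift_inj])
  then show ?thesis
    unfolding exponent_fibre_blow_up[OF assms] by (simp add: sum.reindex)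
qed

lemma finite_exponent_fibre_blow_up:
  assumes "negative_definite G" and "k \<in> carrier_vec n" and "k' = vCons e (k - e \<cdot>\<^sub>v ind)"
  shows "finite (exponent_fibre G' (spinc G' k') a j)"
proof (rule finite_exponent_fibre)
  show "negative_definite G'" using assms(1) negative_definite_blow_up by simp
  show "spinc G' k' \<subseteq> carrier_vec (nverts G')"
    by (rule spinc_carrier) (use assms in \<open>auto simp: nverts'\<close>)
qed

end

section \<open>Neumann moves\<close>

lemma plumbing_tree_edges:
  assumes "plumbing_tree G"
  shows "finite (edges G)" and "{i, j} \<in> edges G \<Longrightarrow> i < nverts G \<and> j < nverts G \<and> i \<noteq> j"
proof -
  have *: "edges G \<subseteq> {{i, j} |i j. i < nverts G \<and> j < nverts G \<and> i \<noteq> j}"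
    using assms by (simp add: plumbing_tree_def)
  then have "edges G \<subseteq> Pow {..<nverts G}" by auto
  then show "finite (edges G)" by (rule finite_subset) simp
  show "{i, j} \<in> edges G \<Longrightarrow> i < nverts G \<and> j < nverts G \<and> i \<noteq> j"
    using * by (fastforce simp: doubleton_eq_iff)
qed

lemma inj_image: "inj f \<Longrightarrow> inj ((`) f)"
  by (simp add: inj_on_def inj_image_eq_iff)

lemma image_in_image_iff: "inj f \<Longrightarrow> f ` e \<in> (`) f ` E \<longleftrightarrow> e \<in> E"
  using inj_image_mem_iff[OF inj_image] .

lemma Suc_doubleton_in_image: "{Suc i, Suc j} \<in> (`) Suc ` E \<longleftrightarrow> {i, j} \<in> E"
  using image_in_image_iff[of Suc "{i, j}" E] by simp

lemma zero_edge_notin_image: "{0, j} \<notin> (`) Suc ` E"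
proof
  assume "{0, j} \<in> (`) Suc ` E"
  then obtain e where "{0, j} = Suc ` e" by (rule imageE)
  then have "0 \<in> Suc ` e" using insertI1[of 0 "{j}"] by (simp only:)
  then show False by simp
qed

lemma card_Suc_edges: "card {e \<in> (`) Suc ` E. Suc i \<in> e} = card {e \<in> E. i \<in> e}"
proof -
  have "{e \<in> (`) Suc ` E. Suc i \<in> e} = (`) Suc ` {e \<in> E. i \<in> e}" by auto
  moreover have "inj_on ((`) Suc) {e \<in> E. i \<in> e}"
    by (rule inj_on_subset[OF inj_image]) auto
  ultimately show ?thesis by (simp only: card_image)
qed

lemma nverts_move_a: "nverts (move_a a b G) = Suc (nverts G)"
  by (simp add: nverts_def move_a_def)

lemma nverts_move_b: "nverts (move_b a G) = Suc (nverts G)"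
  by (simp add: nverts_def move_b_def)

lemma blow_up_move_a:
  assumes G: "plumbing_tree G" and ab: "{a, b} \<in> edges G"
  shows "blow_up G (move_a a b G) {a, b}"
proof
  note E = plumbing_tree_edges(2)[OF G]
  have ab': "a < nverts G" "b < nverts G" "a \<noteq> b" using E[OF ab] by auto
  then show "{a, b} \<subseteq> {..<nverts G}" by simp
  show "nverts (move_a a b G) = Suc (nverts G)" by (rule nverts_move_a)
  show "plumbing_mat (move_a a b G) $$ (0, 0) = - 1"
    by (simp add: plumbing_mat_def nverts_move_a) (simp add: move_a_def)
  have adj0: "adjacent (move_a a b G) 0 (Suc j) \<longleftrightarrow> j \<in> {a, b}" for j
  proof -
    have "adjacent (move_a a b G) 0 (Suc j) \<longleftrightarrow> {0, Suc j} = {0, Suc a} \<or> {0, Suc j} = {0, Suc b}"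
      using zero_edge_notin_image by (simp add: adjacent_def move_a_def)
    then show ?thesis by (simp add: doubleton_eq_iff)
  qed
  show "plumbing_mat (move_a a b G) $$ (0, Suc j) = (if j \<in> {a, b} then 1 else 0)"
    if "j < nverts G" for j
    using that adj0[of j] by (simp add: plumbing_mat_def nverts_move_a)
  have adj: "adjacent (move_a a b G) (Suc i) (Suc j) \<longleftrightarrow> adjacent G i j \<and> {i, j} \<noteq> {a, b}" for i j
  proof -
    have "{Suc i, Suc j} \<noteq> {0, l}" for l
      by (simp add: doubleton_eq_iff)
    then have "adjacent (move_a a b G) (Suc i) (Suc j) \<longleftrightarrow> {Suc i, Suc j} \<in> (`) Suc ` (edges G - {{a, b}})"
      by (simp add: adjacent_def move_a_def)
    then show ?thesis
      unfolding Suc_doubleton_in_image by (simp add: adjacent_def)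
  qed
  show "plumbing_mat (move_a a b G) $$ (Suc i, Suc j)
    = plumbing_mat G $$ (i, j) - (if i \<in> {a, b} \<and> j \<in> {a, b} then 1 else 0)"
    if i: "i < nverts G" and j: "j < nverts G" for i j
  proof (cases "i = j")
    case True
    have "weights (move_a a b G) $ Suc j = weights G $ j - (if j \<in> {a, b} then 1 else 0)"
      using j by (simp add: move_a_def)
    then show ?thesis
      using i by (simp add: plumbing_mat_def nverts_move_a True)
  next
    case False
    then have M: "plumbing_mat G $$ (i, j) = (if adjacent G i j then 1 else 0)"
      "plumbing_mat (move_a a b G) $$ (Suc i, Suc j)
        = (if adjacent (move_a a b G) (Suc i) (Suc j) then 1 else 0)"
      using i j by (simp_all add: plumbing_mat_def nverts_move_a)
    show ?thesis
    proof (cases "i \<in> {a, b} \<and> j \<in> {a, b}")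
      case True
      then have "{i, j} = {a, b}" using False by blast
      moreover from this have "adjacent G i j" using ab by (simp add: adjacent_def)
      ultimately show ?thesis unfolding M adj using True by simp
    next
      case outside: False
      then have "{i, j} \<noteq> {a, b}" by blast
      then show ?thesis unfolding M adj using outside by simp
    qed
  qed
qed

lemma degree_move_a:
  assumes G: "plumbing_tree G" and ab: "{a, b} \<in> edges G"
  shows "degree_of (move_a a b G) 0 = 2" and "degree_of (move_a a b G) (Suc i) = degree_of G i"
proof -
  have ab': "a \<noteq> b" using plumbing_tree_edges(2)[OF G ab] by simp
  have fin: "finite (edges G)" by (rule plumbing_tree_edges(1)[OF G])
  let ?E = "(`) Suc ` (edges G - {{a, b}})"
  have edges: "edges (move_a a b G) = {{0, Suc a}, {0, Suc b}} \<union> ?E"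
    by (simp add: move_a_def)
  have "{e \<in> edges (move_a a b G). 0 \<in> e} = {{0, Suc a}, {0, Suc b}}"
    unfolding edges by auto
  moreover have "{0, Suc a} \<noteq> {0, Suc b}" using ab' by (simp add: doubleton_eq_iff)
  ultimately show "degree_of (move_a a b G) 0 = 2"
    by (simp add: degree_of_def)
  have E: "{e \<in> edges G - {{a, b}}. i \<in> e} = {e \<in> edges G. i \<in> e} - {{a, b}}"
    by auto
  show "degree_of (move_a a b G) (Suc i) = degree_of G i"
  proof (cases "i \<in> {a, b}")
    case True
    have "{e \<in> edges (move_a a b G). Suc i \<in> e} = insert {0, Suc i} {e \<in> ?E. Suc i \<in> e}"
      unfolding edges using True by auto
    moreover have "{0, Suc i} \<notin> {e \<in> ?E. Suc i \<in> e}"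
      using zero_edge_notin_image by blast
    ultimately have "degree_of (move_a a b G) (Suc i) = Suc (card {e \<in> ?E. Suc i \<in> e})"
      using fin by (simp add: degree_of_def)
    also have "\<dots> = Suc (card ({e \<in> edges G. i \<in> e} - {{a, b}}))"
      by (simp only: card_Suc_edges E)
    also have "\<dots> = degree_of G i"
      unfolding degree_of_def by (rule card_Suc_Diff1) (use fin ab True in auto)
    finally show ?thesis .
  next
    case False
    have "{e \<in> edges (move_a a b G). Suc i \<in> e} = {e \<in> ?E. Suc i \<in> e}"
      unfolding edges using False by auto
    moreover have "{e \<in> edges G. i \<in> e} - {{a, b}} = {e \<in> edges G. i \<in> e}"
      using False by auto
    ultimately show ?thesis
      unfolding degree_of_def by (simp only: card_Suc_edges E)
  qed
qed

text \<open>By (A1), \<open>F\<^sub>2\<close> at the new vertex is supported on \<open>0\<close>, so that one lift of each vector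
  contributes, with the old weight.\<close>

lemma limit_coeff_move_a:
  fixes F :: "nat \<Rightarrow> int \<Rightarrow> 'r :: {comm_ring, comm_monoid_mult}"
  assumes F: "admissible F" and G: "plumbing_tree G" "negative_definite G"
    and k: "k \<in> chars G" and ab: "{a, b} \<in> edges G"
  shows "limit_coeff F (move_a a b G) (spinc (move_a a b G) (alpha_a a b k)) x j
    = limit_coeff F G (spinc G k) x j"
proof -
  let ?G' = "move_a a b G" and ?k' = "alpha_a a b k"
  interpret blow_up G ?G' "{a, b}"
    by (rule blow_up_move_a[OF G(1) ab])
  have kc: "k \<in> carrier_vec n" using chars_carrier[OF k] .
  have card: "card {a, b} = 2"
    using plumbing_tree_edges(2)[OF G(1) ab] by simp
  have k': "?k' = vCons 1 (k - 1 \<cdot>\<^sub>v ind)"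
    unfolding alpha_a_def using kc by (auto intro!: eq_vecI)
  have zero: "vertex_weight F ?G' w = 0" if "w $ 0 \<noteq> 0" for w
    using F that unfolding vertex_weight_blow_up degree_move_a(1)[OF G(1) ab]
    by (simp add: admissible_def)
  have same: "vertex_weight F ?G' (lift 0 w) = vertex_weight F G w" if "w \<in> carrier_vec n" for w
  proof -
    have "lift 0 w $ Suc i = w $ i" if "i < n" for i
      using \<open>w \<in> carrier_vec n\<close> that by (simp add: lift_def)
    moreover have "F 2 0 = 1" using F by (simp add: admissible_def)
    ultimately show ?thesis
      unfolding vertex_weight_blow_up degree_move_a[OF G(1) ab] vertex_weight_def[of F G] by simp
  qed
  have "limit_coeff F ?G' (spinc ?G' ?k') x j
    = (\<Sum>w' \<in> {w' \<in> exponent_fibre ?G' (spinc ?G' ?k') x j. w' $ 0 = 0}. vertex_weight F ?G' w')"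
    unfolding limit_coeff_def
    by (rule sum.mono_neutral_right[OF finite_exponent_fibre_blow_up[OF G(2) kc k']]) (auto simp: zero)
  also have "\<dots> = (\<Sum>w \<in> exponent_fibre G (spinc G k) x j. vertex_weight F ?G' (lift 0 w))"
    by (rule sum_lift[OF G(2) kc k']) (simp_all add: card)
  also have "\<dots> = limit_coeff F G (spinc G k) x j"
    unfolding limit_coeff_def
    using spinc_carrier[OF kc] by (intro sum.cong refl same) (auto simp: exponent_fibre_def)
  finally show ?thesis .
qed

lemma blow_up_move_b:
  assumes a: "a < nverts G"
  shows "blow_up G (move_b a G) {a}"
proof
  show "{a} \<subseteq> {..<nverts G}" using a by simp
  show "nverts (move_b a G) = Suc (nverts G)" by (rule nverts_move_b)
  show "plumbing_mat (move_b a G) $$ (0, 0) = - 1"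
    by (simp add: plumbing_mat_def nverts_move_b) (simp add: move_b_def)
  have adj0: "adjacent (move_b a G) 0 (Suc j) \<longleftrightarrow> j \<in> {a}" for j
  proof -
    have "adjacent (move_b a G) 0 (Suc j) \<longleftrightarrow> {0, Suc j} = {0, Suc a}"
      using zero_edge_notin_image by (simp add: adjacent_def move_b_def)
    then show ?thesis by (simp add: doubleton_eq_iff)
  qed
  show "plumbing_mat (move_b a G) $$ (0, Suc j) = (if j \<in> {a} then 1 else 0)"
    if "j < nverts G" for j
    using that adj0[of j] by (simp add: plumbing_mat_def nverts_move_b)
  have adj: "adjacent (move_b a G) (Suc i) (Suc j) \<longleftrightarrow> adjacent G i j" for i j
  proof -
    have "{Suc i, Suc j} \<noteq> {0, Suc a}"
      by (simp add: doubleton_eq_iff)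
    then have "adjacent (move_b a G) (Suc i) (Suc j) \<longleftrightarrow> {Suc i, Suc j} \<in> (`) Suc ` edges G"
      by (simp add: adjacent_def move_b_def)
    then show ?thesis
      unfolding Suc_doubleton_in_image by (simp add: adjacent_def)
  qed
  show "plumbing_mat (move_b a G) $$ (Suc i, Suc j)
    = plumbing_mat G $$ (i, j) - (if i \<in> {a} \<and> j \<in> {a} then 1 else 0)"
    if i: "i < nverts G" and j: "j < nverts G" for i j
  proof (cases "i = j")
    case True
    have "weights (move_b a G) $ Suc j = weights G $ j - (if j \<in> {a} then 1 else 0)"
      using j by (simp add: move_b_def)
    then show ?thesis
      using i by (simp add: plumbing_mat_def nverts_move_b True)
  next
    case False
    then show ?thesis
      using i j adj[of i j] by (auto simp: plumbing_mat_def nverts_move_b)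
  qed
qed

lemma degree_move_b:
  assumes G: "plumbing_tree G"
  shows "degree_of (move_b a G) 0 = 1"
    and "degree_of (move_b a G) (Suc i) = degree_of G i + (if i = a then 1 else 0)"
proof -
  have fin: "finite (edges G)" by (rule plumbing_tree_edges(1)[OF G])
  let ?E = "(`) Suc ` edges G"
  have edges: "edges (move_b a G) = insert {0, Suc a} ?E"
    by (simp add: move_b_def)
  have "{e \<in> edges (move_b a G). 0 \<in> e} = {{0, Suc a}}"
    unfolding edges by auto
  then show "degree_of (move_b a G) 0 = 1"
    by (simp add: degree_of_def)
  show "degree_of (move_b a G) (Suc i) = degree_of G i + (if i = a then 1 else 0)"
  proof (cases "i = a")
    case True
    have "{e \<in> edges (move_b a G). Suc i \<in> e} = insert {0, Suc i} {e \<in> ?E. Suc i \<in> e}"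
      unfolding edges using True by auto
    moreover have "{0, Suc i} \<notin> {e \<in> ?E. Suc i \<in> e}"
      using zero_edge_notin_image by blast
    ultimately have "degree_of (move_b a G) (Suc i) = Suc (card {e \<in> ?E. Suc i \<in> e})"
      using fin by (simp add: degree_of_def)
    then show ?thesis
      using True by (simp only: card_Suc_edges degree_of_def) simp
  next
    case False
    have "{e \<in> edges (move_b a G). Suc i \<in> e} = {e \<in> ?E. Suc i \<in> e}"
      unfolding edges using False by auto
    then show ?thesis
      using False by (simp only: card_Suc_edges degree_of_def) simp
  qed
qed

text \<open>By (A1) and (A2), \<open>F\<^sub>1\<close> is supported on \<open>\<plusminus>1\<close>, so that two lifts of each vector contribute, and
  the recursion (A2) at the vertex \<open>a\<close> combines them into the old weight.\<close>

lemma limit_coeff_move_b: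
  fixes F :: "nat \<Rightarrow> int \<Rightarrow> 'r :: {comm_ring, comm_monoid_mult}"
  assumes F: "admissible F" and G: "plumbing_tree G" "negative_definite G"
    and k: "k \<in> chars G" and a: "a < nverts G"
  shows "limit_coeff F (move_b a G) (spinc (move_b a G) (alpha_b a k)) x j
    = limit_coeff F G (spinc G k) x j"
proof -
  let ?G' = "move_b a G" and ?k' = "alpha_b a k"
  interpret blow_up G ?G' "{a}"
    by (rule blow_up_move_b[OF a])
  have kc: "k \<in> carrier_vec n" using chars_carrier[OF k] .
  have k': "?k' = vCons (- 1) (k - (- 1) \<cdot>\<^sub>v ind)"
    unfolding alpha_b_def using kc by (auto intro!: eq_vecI)
  have rec: "F m (r + 1) - F m (r - 1) = F (m - 1) r" if "m \<ge> 1" for m r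
    using F that by (simp add: admissible_def)
  have F2: "F 2 0 = 1" "r \<noteq> 0 \<Longrightarrow> F 2 r = 0" for r
    using F by (simp_all add: admissible_def)
  have F1: "F 1 (- 1) = 1" "F 1 1 = - 1" and F1_zero: "r \<noteq> 1 \<Longrightarrow> r \<noteq> - 1 \<Longrightarrow> F 1 r = 0" for r
    using rec[of 2 "- 1"] rec[of 2 1] rec[of 2 r] F2 by simp_all
  let ?X = "exponent_fibre ?G' (spinc ?G' ?k') x j"
  have zero: "vertex_weight F ?G' w = 0" if "w $ 0 \<noteq> 1" "w $ 0 \<noteq> - 1" for w
    using F1_zero[OF that] unfolding vertex_weight_blow_up degree_move_b(1)[OF G(1)] by simp
  have same: "vertex_weight F ?G' (lift (- 1) w) + vertex_weight F ?G' (lift 1 w) = vertex_weight F G w"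
    if w: "w \<in> carrier_vec n" for w
  proof -
    let ?r = "\<Prod>i\<in>{..<n} - {a}. F (degree_of G i) (w $ i)"
    have lift: "vertex_weight F ?G' (lift d w) = F 1 d * (F (Suc (degree_of G a)) (w $ a - d) * ?r)" for d
    proof -
      have "(\<Prod>i<n. F (degree_of ?G' (Suc i)) (lift d w $ Suc i))
        = F (degree_of ?G' (Suc a)) (lift d w $ Suc a)
          * (\<Prod>i\<in>{..<n} - {a}. F (degree_of ?G' (Suc i)) (lift d w $ Suc i))"
        by (rule prod.remove) (use a in auto)
      also have "(\<Prod>i\<in>{..<n} - {a}. F (degree_of ?G' (Suc i)) (lift d w $ Suc i)) = ?r"
        using w by (intro prod.cong refl) (auto simp: degree_move_b(2)[OF G(1)] lift_def)
      finally show ?thesis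
        unfolding vertex_weight_blow_up degree_move_b[OF G(1)] using w a by (simp add: lift_def)
    qed
    have "vertex_weight F ?G' (lift (- 1) w) + vertex_weight F ?G' (lift 1 w)
      = (F (Suc (degree_of G a)) (w $ a + 1) - F (Suc (degree_of G a)) (w $ a - 1)) * ?r"
      unfolding lift F1 by (simp add: algebra_simps)
    also have "\<dots> = F (degree_of G a) (w $ a) * ?r"
      using rec[of "Suc (degree_of G a)" "w $ a"] by simp
    also have "\<dots> = vertex_weight F G w"
      unfolding vertex_weight_def by (rule prod.remove[symmetric]) (use a in auto)
    finally show ?thesis .
  qed
  have fin: "finite ?X"
    by (rule finite_exponent_fibre_blow_up[OF G(2) kc k'])
  have "limit_coeff F ?G' (spinc ?G' ?k') x j
    = (\<Sum>w' \<in> {w' \<in> ?X. w' $ 0 = - 1} \<union> {w' \<in> ?X. w' $ 0 = 1}. vertex_weight F ?G' w')"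
    unfolding limit_coeff_def by (rule sum.mono_neutral_right[OF fin]) (auto simp: zero)
  also have "\<dots> = (\<Sum>w' \<in> {w' \<in> ?X. w' $ 0 = - 1}. vertex_weight F ?G' w')
      + (\<Sum>w' \<in> {w' \<in> ?X. w' $ 0 = 1}. vertex_weight F ?G' w')"
    by (rule sum.union_disjoint) (use fin in auto)
  also have "\<dots> = (\<Sum>w \<in> exponent_fibre G (spinc G k) x j. vertex_weight F ?G' (lift (- 1) w))
      + (\<Sum>w \<in> exponent_fibre G (spinc G k) x j. vertex_weight F ?G' (lift 1 w))"
    by (intro arg_cong2[where f = "(+)"] sum_lift[OF G(2) kc k']) simp_all
  also have "\<dots> = limit_coeff F G (spinc G k) x j"
    unfolding limit_coeff_def sum.distrib[symmetric]
    using spinc_carrier[OF kc] by (intro sum.cong refl same) (auto simp: exponent_fibre_def)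
  finally show ?thesis .
qed

section \<open>Reordering the vertices\<close>

text \<open>The permutation of entries for vectors over an arbitrary type; rational and real vectors
  are permuted along with integral ones.\<close>

definition permute_vec :: "(nat \<Rightarrow> nat) \<Rightarrow> 'a vec \<Rightarrow> 'a vec" where
  "permute_vec p v = vec (dim_vec v) (\<lambda>i. v $ p i)"

lemma dim_permute_vec [simp]: "dim_vec (permute_vec p v) = dim_vec v"
  by (simp add: permute_vec_def)

lemma permute_vec_carrier [simp]: "permute_vec p v \<in> carrier_vec n \<longleftrightarrow> v \<in> carrier_vec n"
  unfolding carrier_vec_def mem_Collect_eq dim_permute_vec ..

lemma permute_vec_index [simp]: "i < dim_vec v \<Longrightarrow> permute_vec p v $ i = v $ p i"
  by (simp add: permute_vec_def)

lemma perm_vec_eq: "perm_vec p = permute_vec p"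
  by (rule ext) (simp add: perm_vec_def permute_vec_def)

locale reordered_plumbing =
  fixes G :: plumbing and p :: "nat \<Rightarrow> nat"
  assumes p: "p permutes {..<nverts G}"
begin

abbreviation G' where "G' \<equiv> reorder p G"
abbreviation n where "n \<equiv> nverts G"
abbreviation q where "q \<equiv> inv_into UNIV p"

lemma p_less: "i < n \<Longrightarrow> p i < n"
  using permutes_in_image[OF p, of i] by simp

lemma sum_permute: "(\<Sum>i<n. f (p i)) = (\<Sum>i<n. f i)"
  by (rule sum.permute[OF p, of f, unfolded o_def, symmetric])

lemma nverts_reorder [simp]: "nverts G' = n"
  by (simp add: nverts_def reorder_def perm_vec_def)

lemma edges_reorder: "edges G' = (`) q ` edges G"
  by (simp add: reorder_def)

lemma inj_q: "inj q"
  by (rule permutes_inj[OF permutes_inv[OF p]])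

lemma q_p [simp]: "q (p i) = i" and p_q [simp]: "p (q i) = i"
  using permutes_inverses[OF p] by simp_all

lemma edge_reorder_iff: "q ` e \<in> edges G' \<longleftrightarrow> e \<in> edges G"
  unfolding edges_reorder by (rule image_in_image_iff[OF inj_q])

lemma adjacent_reorder: "adjacent G' i j \<longleftrightarrow> adjacent G (p i) (p j)"
  using edge_reorder_iff[of "{p i, p j}"] by (simp add: adjacent_def)

lemma plumbing_mat_reorder:
  assumes "i < n" "j < n"
  shows "plumbing_mat G' $$ (i, j) = plumbing_mat G $$ (p i, p j)"
proof -
  have "weights G' $ j = weights G $ p j"
    using assms by (simp add: reorder_def perm_vec_def nverts_def)
  moreover have "p i = p j \<longleftrightarrow> i = j"
    using permutes_inj[OF p] by (simp add: inj_eq)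
  ultimately show ?thesis
    using assms by (simp add: plumbing_mat_def p_less adjacent_reorder)
qed

lemma degree_reorder: "degree_of G' i = degree_of G (p i)"
proof -
  have "{e \<in> edges G'. i \<in> e} = (`) q ` {e \<in> edges G. p i \<in> e}"
  proof -
    have "i \<in> q ` e \<longleftrightarrow> p i \<in> e" for e
      using inj_image_mem_iff[OF inj_q, of "p i" e] by simp
    then show ?thesis unfolding edges_reorder by auto
  qed
  moreover have "inj_on ((`) q) {e \<in> edges G. p i \<in> e}"
    by (rule inj_on_subset[OF inj_image[OF inj_q]]) simp
  ultimately show ?thesis
    by (simp add: degree_of_def card_image)
qed

lemma form_mat_reorder:
  fixes x :: "'a :: comm_ring_1 vec"
  assumes x: "x \<in> carrier_vec n"
  shows "form_mat G' *\<^sub>v permute_vec p x = permute_vec p (form_mat G *\<^sub>v x)"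
proof (rule eq_vecI)
  fix i assume "i < dim_vec (permute_vec p (form_mat G *\<^sub>v x))"
  then have i: "i < n" by simp
  have "(form_mat G' *\<^sub>v permute_vec p x) $ i
    = (\<Sum>j<n. of_int (plumbing_mat G $$ (p i, p j)) * x $ p j)"
    using x i form_mat_mult_index[of "permute_vec p x" G' i] by (simp add: plumbing_mat_reorder)
  also have "\<dots> = (\<Sum>j<n. of_int (plumbing_mat G $$ (p i, j)) * x $ j)"
    by (rule sum_permute)
  also have "\<dots> = (form_mat G *\<^sub>v x) $ p i"
    using form_mat_mult_index[OF x p_less[OF i]] by simp
  finally show "(form_mat G' *\<^sub>v permute_vec p x) $ i = permute_vec p (form_mat G *\<^sub>v x) $ i"
    using i by (simp del: index_mult_mat_vec)
qed simp

lemma scalar_prod_permute: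
  "v \<in> carrier_vec n \<Longrightarrow> w \<in> carrier_vec n \<Longrightarrow> permute_vec p v \<bullet> permute_vec p w = v \<bullet> w"
  using sum_permute[of "\<lambda>i. v $ i * w $ i"] by (simp add: scalar_prod_sum[of _ n])

lemma permute_vec_inj: "inj_on (permute_vec p) (carrier_vec n)"
proof (rule inj_onI)
  fix v w :: "'a vec" assume v: "v \<in> carrier_vec n" and w: "w \<in> carrier_vec n"
    and eq: "permute_vec p v = permute_vec p w"
  show "v = w"
  proof (rule eq_vecI)
    fix i assume "i < dim_vec w"
    then have i: "i < n" using w by simp
    then have "q i < n" using permutes_in_image[OF permutes_inv[OF p], of i] by simp
    then show "v $ i = w $ i"
      using arg_cong[OF eq, of "\<lambda>u. u $ q i"] v w by simp
  qed (use v w in simp)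
qed

lemma permute_vec_surj:
  assumes v: "v \<in> carrier_vec n"
  obtains w where "w \<in> carrier_vec n" "v = permute_vec p w"
proof (rule that[of "permute_vec q v"])
  show "v = permute_vec p (permute_vec q v)"
    using v p_less by (intro eq_vecI) auto
qed (use v in simp)

lemma permute_vec_image: "permute_vec p ` carrier_vec n = carrier_vec n"
proof
  show "carrier_vec n \<subseteq> permute_vec p ` carrier_vec n"
    using permute_vec_surj by (metis image_eqI subsetI)
qed auto

lemma permute_vec_zero: "v \<in> carrier_vec n \<Longrightarrow> permute_vec p v = 0\<^sub>v n \<longleftrightarrow> v = 0\<^sub>v n"
proof -
  assume v: "v \<in> carrier_vec n"
  have "permute_vec p (0\<^sub>v n) = (0\<^sub>v n :: 'a vec)"
    using p_less by (intro eq_vecI) auto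
  then show ?thesis
    using inj_on_eq_iff[OF permute_vec_inj v zero_carrier_vec] by simp
qed

lemma negative_definite_reorder: "negative_definite G' \<longleftrightarrow> negative_definite G"
proof -
  have form: "permute_vec p v \<bullet> (form_mat G' *\<^sub>v permute_vec p v) = v \<bullet> (form_mat G *\<^sub>v v)"
    if "v \<in> carrier_vec n" for v :: "real vec"
    using that by (simp add: form_mat_reorder scalar_prod_permute)
  have "negative_definite G' \<longleftrightarrow> (\<forall>v \<in> permute_vec p ` carrier_vec n. v \<noteq> 0\<^sub>v n \<longrightarrow>
      v \<bullet> (form_mat G' *\<^sub>v v) < (0 :: real))"
    unfolding negative_definite_iff nverts_reorder permute_vec_image ..
  also have "\<dots> \<longleftrightarrow> negative_definite G"
    unfolding negative_definite_iff ball_simps(9) using form permute_vec_zero by auto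
  finally show ?thesis .
qed

lemma inverse_square_reorder:
  assumes G: "negative_definite G" and w: "w \<in> carrier_vec n"
  shows "inverse_square G' (permute_vec p w) = inverse_square G w"
proof -
  obtain z where z: "z \<in> carrier_vec n" "form_mat G *\<^sub>v z = map_vec rat_of_int w"
    using inverse_square_preimage[OF G w] .
  have "form_mat G' *\<^sub>v permute_vec p z = map_vec rat_of_int (permute_vec p w)"
    unfolding form_mat_reorder[OF z(1)] z(2) using w p_less by (intro eq_vecI) auto
  then have "inverse_square G' (permute_vec p w) = permute_vec p z \<bullet> (form_mat G' *\<^sub>v permute_vec p z)"
    using z(1) w G negative_definite_reorder by (intro negative_definite_form_eq) auto
  also have "\<dots> = z \<bullet> (form_mat G *\<^sub>v z)"
    using z(1) by (simp add: form_mat_reorder scalar_prod_permute)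
  also have "\<dots> = inverse_square G w"
    using negative_definite_form_eq[OF G z w] by simp
  finally show ?thesis .
qed

lemma energy_reorder:
  assumes "negative_definite G" "w \<in> carrier_vec n"
  shows "energy G' (permute_vec p w) = energy G w"
proof -
  have "(\<Sum>i<n. weights G' $ i) = (\<Sum>i<n. weights G $ p i)"
    by (intro sum.cong) (auto simp: reorder_def perm_vec_def nverts_def)
  also have "\<dots> = (\<Sum>i<n. weights G $ i)"
    by (rule sum_permute)
  finally show ?thesis
    unfolding energy_def inverse_square_reorder[OF assms] nverts_reorder by simp
qed

lemma ones_reorder: "ones G' = permute_vec p (ones G)"
  using p_less by (intro eq_vecI) (auto simp: ones_def)

lemma shifted_char_reorder:
  assumes k: "k \<in> carrier_vec n" and x: "x \<in> carrier_vec n"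
  shows "shifted_char G' (permute_vec p k) (permute_vec p x) = permute_vec p (shifted_char G k x)"
proof -
  note M = form_mat_reorder[where 'a = int, unfolded form_mat_int]
  show ?thesis
    unfolding shifted_char_def M[OF x] ones_reorder M[OF ones_carrier]
    using k p_less plumbing_mat_mult_carrier[OF x]
    by (intro eq_vecI) (auto simp del: index_mult_mat_vec)
qed

lemma exponent_fibre_reorder:
  assumes G: "negative_definite G" and k: "k \<in> carrier_vec n"
  shows "exponent_fibre G' (spinc G' (permute_vec p k)) a j = permute_vec p ` exponent_fibre G (spinc G k) a j"
proof -
  have k': "permute_vec p k \<in> carrier_vec (nverts G')" using k by simp
  define C where "C = shifted_char G k ` carrier_vec n"
  have C: "w \<in> carrier_vec n" if "w \<in> C" for w
    using that shifted_char_carrier[OF k] by (auto simp: C_def)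
  have "shifted_char G' (permute_vec p k) ` carrier_vec (nverts G')
    = (\<lambda>x. shifted_char G' (permute_vec p k) (permute_vec p x)) ` carrier_vec n"
    unfolding nverts_reorder by (subst (1) permute_vec_image[symmetric]) (simp only: image_image)
  also have "\<dots> = permute_vec p ` C"
    unfolding C_def image_image by (intro image_cong refl shifted_char_reorder[OF k])
  finally have "shifted_char G' (permute_vec p k) ` carrier_vec (nverts G') = permute_vec p ` C" .
  moreover have "energy G' (permute_vec p w) = energy G w" "permute_vec p w \<bullet> ones G' = w \<bullet> ones G"
    if "w \<in> C" for w
    using energy_reorder[OF G C[OF that]] scalar_prod_permute[OF C[OF that] ones_carrier]
    by (simp_all add: ones_reorder)
  ultimately show ?thesis
    unfolding exponent_fibre_def shift_spinc[OF k'] shift_spinc[OF k] C_def[symmetric]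
    by (auto simp: image_iff)
qed

lemma vertex_weight_reorder:
  assumes "w \<in> carrier_vec n"
  shows "vertex_weight F G' (permute_vec p w) = vertex_weight F G w"
proof -
  have "vertex_weight F G' (permute_vec p w) = (\<Prod>i<n. F (degree_of G (p i)) (w $ p i))"
    unfolding vertex_weight_def nverts_reorder
    using assms by (intro prod.cong) (auto simp: degree_reorder)
  also have "\<dots> = vertex_weight F G w"
    unfolding vertex_weight_def
    by (rule prod.permute[OF p, of "\<lambda>i. F (degree_of G i) (w $ i)", unfolded o_def, symmetric])
  finally show ?thesis .
qed

lemma limit_coeff_reorder:
  assumes G: "negative_definite G" and k: "k \<in> carrier_vec n"
  shows "limit_coeff F G' (spinc G' (permute_vec p k)) a j = limit_coeff F G (spinc G k) a j"
proof -
  have C: "exponent_fibre G (spinc G k) a j \<subseteq> carrier_vec n"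
    using spinc_carrier[OF k] by (auto simp: exponent_fibre_def)
  have "inj_on (permute_vec p) (exponent_fibre G (spinc G k) a j)"
    by (rule inj_on_subset[OF permute_vec_inj C])
  then show ?thesis
    unfolding limit_coeff_def exponent_fibre_reorder[OF assms]
    using C by (simp add: sum.reindex) (intro sum.cong refl vertex_weight_reorder, blast)
qed

end

section \<open>Invariance\<close>

text \<open>Definiteness is transported in both directions, so that it need not be assumed for the
  intermediate graphs of a chain of moves.\<close>

lemma neumann_step_invariance:
  assumes step: "neumann_step X Y" and F: "admissible F"
  shows "negative_definite (fst Y) \<longleftrightarrow> negative_definite (fst X)"
    and "negative_definite (fst X) \<Longrightarrow> limit_coeff F (fst Y) (snd Y) = limit_coeff F (fst X) (snd X)"
proof -
  have "(negative_definite (fst Y) \<longleftrightarrow> negative_definite (fst X)) \<and>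
    (negative_definite (fst X) \<longrightarrow> limit_coeff F (fst Y) (snd Y) = limit_coeff F (fst X) (snd X))"
    using step
  proof cases
    case (type_a G k a b)
    interpret blow_up G "move_a a b G" "{a, b}"
      by (rule blow_up_move_a) fact+
    show ?thesis
      using negative_definite_blow_up limit_coeff_move_a[OF F] type_a by (simp add: fun_eq_iff)
  next
    case (type_b G k a)
    interpret blow_up G "move_b a G" "{a}"
      by (rule blow_up_move_b) fact+
    show ?thesis
      using negative_definite_blow_up limit_coeff_move_b[OF F] type_b by (simp add: fun_eq_iff)
  next
    case (reordering G k p)
    interpret reordered_plumbing G p
      by unfold_locales fact
    show ?thesis
      using negative_definite_reorder limit_coeff_reorder[of k F] chars_carrier[of k G] reordering
      by (simp add: fun_eq_iff perm_vec_eq)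
  qed
  then show "negative_definite (fst Y) \<longleftrightarrow> negative_definite (fst X)"
    and "negative_definite (fst X) \<Longrightarrow> limit_coeff F (fst Y) (snd Y) = limit_coeff F (fst X) (snd X)"
    by simp_all
qed

lemma equivclp_neumann_invariance:
  assumes "equivclp neumann_step X Y" and F: "admissible F" and X: "negative_definite (fst X)"
  shows "negative_definite (fst Y) \<and> limit_coeff F (fst Y) (snd Y) = limit_coeff F (fst X) (snd X)"
  using assms(1)
proof (induction rule: equivclp_induct)
  case base
  show ?case using X by simp
next
  case (step Y Z)
  from step.hyps(2) show ?case
  proof
    assume "neumann_step Y Z"
    from neumann_step_invariance[OF this F] step.IH show ?thesis by simp
  next
    assume "neumann_step Z Y"
    from neumann_step_invariance[OF this F] step.IH show ?thesis by simp
  qed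
qed

theorem theorem6p2:
  fixes F :: "nat \<Rightarrow> int \<Rightarrow> 'r :: {comm_ring, comm_monoid_mult}"
    and G :: plumbing and k :: "int vec" and n0 :: int
  assumes "admissible F"
    and "plumbing_tree G" and "negative_definite G"
    and "k \<in> chars G"
    and "chi_lower_bound G k n0"
  shows "stabilizes (Delta G k) (P_seq F G k n0) \<and>
    P_infty F G k n0 \<in> shifted_laurent_series (Delta G k) \<and>
    (\<forall>k' n0'. k' \<in> spinc G k \<and> chi_lower_bound G k' n0' \<longrightarrow>
       P_infty F G k' n0' = P_infty F G k n0) \<and>
    (\<forall>G' k' n0'. plumbing_tree G' \<and> negative_definite G' \<and> k' \<in> chars G' \<and>
       chi_lower_bound G' k' n0' \<and>
       equivclp neumann_step (G, spinc G k) (G', spinc G' k') \<longrightarrow>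
       P_infty F G' k' n0' = P_infty F G k n0)"
proof (intro conjI allI impI)
  note G = assms(3) and k = assms(4)
  show "stabilizes (Delta G k) (P_seq F G k n0)"
    by (rule stabilizes_P_seq[OF G k])
  show "P_infty F G k n0 \<in> shifted_laurent_series (Delta G k)"
    unfolding P_infty_eq[OF G k] by (rule limit_coeff_laurent[OF G k])
  show "P_infty F G k' n0' = P_infty F G k n0"
    if "k' \<in> spinc G k \<and> chi_lower_bound G k' n0'" for k' n0'
  proof -
    from that have k': "k' \<in> spinc G k" by simp
    then have "k' \<in> chars G" using spinc_subset_chars[OF k] by blast
    then show ?thesis
      unfolding P_infty_eq[OF G k] P_infty_eq[OF G \<open>k' \<in> chars G\<close>] spinc_eq[OF chars_carrier[OF k] k'] by simp
  qed
  show "P_infty F G' k' n0' = P_infty F G k n0"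
    if "plumbing_tree G' \<and> negative_definite G' \<and> k' \<in> chars G' \<and> chi_lower_bound G' k' n0' \<and>
       equivclp neumann_step (G, spinc G k) (G', spinc G' k')" for G' k' n0'
  proof -
    from that have G': "negative_definite G'" and k': "k' \<in> chars G'"
      and eq: "equivclp neumann_step (G, spinc G k) (G', spinc G' k')" by simp_all
    show ?thesis
      using equivclp_neumann_invariance[OF eq assms(1)] G
      unfolding P_infty_eq[OF G k] P_infty_eq[OF G' k'] by simp
  qed
qed

end
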